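(* The quintuple $(\mathbf{k}\mathcal{F},\, m_{RT},\, 1,\, \Delta_\epsilon,\, B^+)$ is the free cocycle $\epsilon$-unitary Hopf algebra on the empty set, that is, the initial object in the category of cocycle $\epsilon$-unitary Hopf algebras.
   Context: Let $\mathbf{k}$ be a field of characteristic $0$; linear maps and tensor products are over $\mathbf{k}$. For an associative algebra $A$, view $A\otimes A$ as an $A$-bimodule via $a\cdot(b\otimes c):=ab\otimes c$ and $(b\otimes c)\cdot a:=b\otimes ca$. An infinitesimal unitary bialgebra ($\epsilon$-unitary bialgebra) is a quadruple $(A,m,1,\Delta)$ where $(A,m,1)$ is a unitary associative algebra, $(A,\Delta)$ is a coassociative coalgebra (no counit required), and $\Delta(ab)=a\cdot\Delta(b)+\Delta(a)\cdot b$ for all $a,b\in A$. An $\epsilon$-unitary bialgebra morphism is a map that is both a unitary algebra morphism and a coalgebra morphism. On $\mathrm{Hom}_{\mathbf{k}}(A,A)$ the convolution is $f*g=m(f\otimes g)\Delta$ and the circular convolution is $f\circledast g:=f*g+f+g$, for which the zero map is the unit. An $\epsilon$-unitary bialgebra $A$ is an $\epsilon$-unitary Hopf algebra if $\mathrm{id}\in\mathrm{Hom}_{\mathbf{k}}(A,A)$ is invertible with respect to $\circledast$; its inverse $S$ is called the antipode. An $\epsilon$-unitary Hopf algebra morphism $\phi:H\to L$ is an $\epsilon$-unitary bialgebra morphism with $S_L\phi=\phi S_H$. An operated $\epsilon$-unitary Hopf algebra $(H,m,1,\Delta,P)$ is an $\epsilon$-unitary Hopf algebra with a linear operator $P:H\to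 H$. A morphism of operated $\epsilon$-unitary Hopf algebras $\phi:(H,P_H)\to(L,P_L)$ is an $\epsilon$-unitary Hopf algebra morphism with $\phi P_H=P_L\phi$. A cocycle $\epsilon$-unitary Hopf algebra is an operated $\epsilon$-unitary Hopf algebra with $\Delta P=\mathrm{id}\otimes 1+(\mathrm{id}\otimes P)\Delta$, i.e. $\Delta(P(a))=a\otimes 1+(\mathrm{id}\otimes P)\Delta(a)$ for all $a\in H$; morphisms of cocycle $\epsilon$-unitary Hopf algebras are morphisms of operated $\epsilon$-unitary Hopf algebras. The free cocycle $\epsilon$-unitary Hopf algebra on a set $X$ is a cocycle $\epsilon$-unitary Hopf algebra $(H_X,m_X,1_X,\Delta_X,P_X)$ together with a set map $j_X:X\to H_X$ such that, for any cocycle $\epsilon$-unitary Hopf algebra $(H,m,1,\Delta,P)$ and any set map $f:X\to H$ with $\Delta(f(x))=1\otimes 1$ for all $x\in X$, there is a unique morphism $\bar f:H_X\to H$ of operated $\epsilon$-unitary Hopf algebras with $\bar f j_X=f$. (For $X=\emptyset$ the map $j_X$ is the empty map.) $\mathcal{F}$ is the set of (undecorated) planar rooted forests, i.e. the free monoid generated by the nonempty planar rooted trees, with concatenation as product and the empty tree $1$ as identity; $\mathbf{k}\mathcal{F}$ is the $\mathbf{k}$-vector space with basis $\mathcal{F}$, with the linearly extended concatenation product $m_{RT}$. $B^+:\mathbf{k}\mathcal{F}\to\mathbf{k}\mathcal{F}$ is the linear grafting map: $B^+(1)$ is the one-vertex tree, and $B^+$ of a forest is the tree obtained by grafting it onto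 a new root. Every nonempty tree is $B^+(\bar F)$ for a unique forest $\bar F\in\mathcal{F}$. The linear map $\Delta_\epsilon:\mathbf{k}\mathcal{F}\to\mathbf{k}\mathcal{F}\otimes\mathbf{k}\mathcal{F}$ is defined recursively by: $\Delta_\epsilon(1)=0$; $\Delta_\epsilon(B^+(\bar F))=\bar F\otimes 1+(\mathrm{id}\otimes B^+)\Delta_\epsilon(\bar F)$ for $\bar F\in\mathcal{F}$; and $\Delta_\epsilon(T_1T_2\cdots T_m)=T_1\cdot\Delta_\epsilon(T_2\cdots T_m)+\Delta_\epsilon(T_1)\cdot(T_2\cdots T_m)$ for nonempty planar rooted trees $T_1,\dots,T_m$, $m\ge 2$. *)

theory Defs
  imports Complex_Main "HOL-Library.Poly_Mapping"
begin

section \<open>Free vector spaces\<close>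

text \<open>The free vector space on \<open>'x\<close> over \<open>'k\<close> is the type \<open>'x \<Rightarrow>\<^sub>0 'k\<close> of finitely supported
  functions; \<open>x\<close> as a basis vector is \<open>single x 1\<close>.\<close>

definition pm_scale :: "'k::field \<Rightarrow> ('x \<Rightarrow>\<^sub>0 'k) \<Rightarrow> ('x \<Rightarrow>\<^sub>0 'k)" where
  "pm_scale c u = Poly_Mapping.map ((*) c) u"

definition basis_vec :: "'x \<Rightarrow> ('x \<Rightarrow>\<^sub>0 'k::field)" where
  "basis_vec x = Poly_Mapping.single x 1"

text \<open>The linear extension to \<open>'x \<Rightarrow>\<^sub>0 'k\<close> of a map \<open>f\<close> defined on the basis \<open>'x\<close>; \<open>s\<close> is the
  scalar multiplication of the target.\<close>

definition lin_ext ::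
  "('k::field \<Rightarrow> 'v::ab_group_add \<Rightarrow> 'v) \<Rightarrow> ('x \<Rightarrow> 'v) \<Rightarrow> ('x \<Rightarrow>\<^sub>0 'k) \<Rightarrow> 'v" where
  "lin_ext s f u = (\<Sum>x\<in>Poly_Mapping.keys u. s (Poly_Mapping.lookup u x) (f x))"

lemma lookup_pm_scale [simp]:
  "Poly_Mapping.lookup (pm_scale c u) x = c * Poly_Mapping.lookup u x"
  by (simp add: pm_scale_def Poly_Mapping.map.rep_eq when_def)

lemma vector_space_pm_scale: "vector_space (pm_scale :: 'k::field \<Rightarrow> ('x \<Rightarrow>\<^sub>0 'k) \<Rightarrow> _)"
  by unfold_locales (auto intro!: poly_mapping_eqI simp: lookup_add algebra_simps)


section \<open>Tensor powers\<close>

text \<open>\<open>A \<otimes> A\<close> and \<open>A \<otimes> A \<otimes> A\<close> are the quotients of the free vector spaces on \<open>A \<times> A\<close> and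
  \<open>A \<times> A \<times> A\<close> by the subspaces generated by the bilinearity, respectively trilinearity,
  relations. These subspaces depend on the scalar multiplication \<open>s\<close> of \<open>A\<close>, so the quotients
  are sets of cosets rather than types.\<close>

definition tensor2_null ::
  "('k::field \<Rightarrow> 'a::ab_group_add \<Rightarrow> 'a) \<Rightarrow> (('a \<times> 'a) \<Rightarrow>\<^sub>0 'k) set" where
  "tensor2_null s = module.span pm_scale
     ({basis_vec (a + a', b) - basis_vec (a, b) - basis_vec (a', b) | a a' b. True} \<union>
      {basis_vec (a, b + b') - basis_vec (a, b) - basis_vec (a, b') | a b b'. True} \<union>
      {basis_vec (s c a, b) - pm_scale c (basis_vec (a, b)) | c a b. True} \<union>
      {basis_vec (a, s c b) - pm_scale c (basis_vec (a, b)) | c a b. True})"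

definition tensor3_null ::
  "('k::field \<Rightarrow> 'a::ab_group_add \<Rightarrow> 'a) \<Rightarrow> (('a \<times> 'a \<times> 'a) \<Rightarrow>\<^sub>0 'k) set" where
  "tensor3_null s = module.span pm_scale
     ({basis_vec (a + a', b, d) - basis_vec (a, b, d) - basis_vec (a', b, d) | a a' b d. True} \<union>
      {basis_vec (a, b + b', d) - basis_vec (a, b, d) - basis_vec (a, b', d) | a b b' d. True} \<union>
      {basis_vec (a, b, d + d') - basis_vec (a, b, d) - basis_vec (a, b, d') | a b d d'. True} \<union>
      {basis_vec (s c a, b, d) - pm_scale c (basis_vec (a, b, d)) | c a b d. True} \<union>
      {basis_vec (a, s c b, d) - pm_scale c (basis_vec (a, b, d)) | c a b d. True} \<union>
      {basis_vec (a, b, s c d) - pm_scale c (basis_vec (a, b, d)) | c a b d. True})"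

definition coset :: "'v::ab_group_add set \<Rightarrow> 'v \<Rightarrow> 'v set" where
  "coset N u = {v. v - u \<in> N}"

text \<open>Operations on quotient spaces are computed on a chosen representative \<open>rep U\<close> of the coset
  \<open>U\<close>. Whenever the maps involved are linear, the result does not depend on this choice.\<close>

definition rep :: "'v set \<Rightarrow> 'v" where
  "rep U = (SOME u. u \<in> U)"

type_synonym ('k, 'a) tensor2 = "(('a \<times> 'a) \<Rightarrow>\<^sub>0 'k) set"
type_synonym ('k, 'a) tensor3 = "(('a \<times> 'a \<times> 'a) \<Rightarrow>\<^sub>0 'k) set"

definition tensor2_space ::
  "('k::field \<Rightarrow> 'a::ab_group_add \<Rightarrow> 'a) \<Rightarrow> ('k, 'a) tensor2 set" where
  "tensor2_space s = range (coset (tensor2_null s))"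

definition tensor2_zero ::
  "('k::field \<Rightarrow> 'a::ab_group_add \<Rightarrow> 'a) \<Rightarrow> ('k, 'a) tensor2" where
  "tensor2_zero s = coset (tensor2_null s) 0"

definition tensor2_add ::
  "('k::field \<Rightarrow> 'a::ab_group_add \<Rightarrow> 'a) \<Rightarrow>
   ('k, 'a) tensor2 \<Rightarrow> ('k, 'a) tensor2 \<Rightarrow> ('k, 'a) tensor2" where
  "tensor2_add s U V = coset (tensor2_null s) (rep U + rep V)"

definition tensor2_scale ::
  "('k::field \<Rightarrow> 'a::ab_group_add \<Rightarrow> 'a) \<Rightarrow> 'k \<Rightarrow> ('k, 'a) tensor2 \<Rightarrow> ('k, 'a) tensor2" where
  "tensor2_scale s c U = coset (tensor2_null s) (pm_scale c (rep U))"

definition tensor2_pure ::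
  "('k::field \<Rightarrow> 'a::ab_group_add \<Rightarrow> 'a) \<Rightarrow> 'a \<Rightarrow> 'a \<Rightarrow> ('k, 'a) tensor2" where
  "tensor2_pure s a b = coset (tensor2_null s) (basis_vec (a, b))"

text \<open>\<open>f \<otimes> g : A \<otimes> A \<rightarrow> B \<otimes> B\<close> for linear maps \<open>f, g : A \<rightarrow> B\<close>; \<open>s\<close> is the scalar multiplication
  of \<open>B\<close>.\<close>

definition tensor2_map ::
  "('k::field \<Rightarrow> 'b::ab_group_add \<Rightarrow> 'b) \<Rightarrow> ('a \<Rightarrow> 'b) \<Rightarrow> ('a \<Rightarrow> 'b) \<Rightarrow>
   ('k, 'a) tensor2 \<Rightarrow> ('k, 'b) tensor2" where
  "tensor2_map s f g U =
     coset (tensor2_null s) (lin_ext pm_scale (\<lambda>(a, b). basis_vec (f a, g b)) (rep U))"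

text \<open>The linear map \<open>A \<otimes> A \<rightarrow> V\<close> induced by a bilinear map \<open>\<beta> : A \<times> A \<rightarrow> V\<close>; \<open>s\<close> is the scalar
  multiplication of \<open>V\<close>.\<close>

definition tensor2_lift ::
  "('k::field \<Rightarrow> 'v::ab_group_add \<Rightarrow> 'v) \<Rightarrow> ('a \<Rightarrow> 'a \<Rightarrow> 'v) \<Rightarrow> ('k, 'a) tensor2 \<Rightarrow> 'v" where
  "tensor2_lift s \<beta> U = lin_ext s (\<lambda>(a, b). \<beta> a b) (rep U)"

text \<open>The universal property of \<open>A \<otimes> A\<close>: a bilinear map factors through the quotient.\<close>

lemma lin_ext_superset:
  assumes "vector_space s" "finite K" "Poly_Mapping.keys u \<subseteq> K"
  shows "lin_ext s f u = (\<Sum>x\<in>K. s (Poly_Mapping.lookup u x) (f x))"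
proof -
  interpret vector_space s by fact
  show ?thesis
    unfolding lin_ext_def using assms(2,3)
    by (intro sum.mono_neutral_left) (auto simp: in_keys_iff)
qed

lemma linear_lin_ext:
  assumes "vector_space s"
  shows "Vector_Spaces.linear pm_scale s (lin_ext s f)"
proof -
  interpret V: vector_space s by fact
  interpret P: vector_space "pm_scale :: 'a \<Rightarrow> ('c \<Rightarrow>\<^sub>0 'a) \<Rightarrow> _" by (rule vector_space_pm_scale)
  show ?thesis
  proof unfold_locales
    fix u v :: "'c \<Rightarrow>\<^sub>0 'a"
    let ?K = "Poly_Mapping.keys u \<union> Poly_Mapping.keys v"
    have "Poly_Mapping.keys (u + v) \<subseteq> ?K" by (rule keys_add)
    then show "lin_ext s f (u + v) = lin_ext s f u + lin_ext s f v"
      by (simp add: lin_ext_superset[OF assms, of ?K] lookup_add V.scale_left_distrib sum.distrib)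
  next
    fix c and u :: "'c \<Rightarrow>\<^sub>0 'a"
    have "Poly_Mapping.keys (pm_scale c u) \<subseteq> Poly_Mapping.keys u"
      by (auto simp: in_keys_iff)
    then show "lin_ext s f (pm_scale c u) = s c (lin_ext s f u)"
      by (simp add: lin_ext_superset[OF assms, of "Poly_Mapping.keys u"] V.scale_sum_right)
  qed
qed

lemma lin_ext_basis_vec [simp]:
  assumes "vector_space s"
  shows "lin_ext s f (basis_vec x) = f x"
proof -
  interpret vector_space s by fact
  show ?thesis by (simp add: lin_ext_def basis_vec_def)
qed

lemma lin_ext_tensor2_null:
  assumes V: "vector_space s'"
    and l: "\<And>b. Vector_Spaces.linear s s' (\<lambda>a. \<beta> a b)"
    and r: "\<And>a. Vector_Spaces.linear s s' (\<beta> a)"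
    and u: "u \<in> tensor2_null s"
  shows "lin_ext s' (\<lambda>(a, b). \<beta> a b) u = 0"
proof -
  interpret L: Vector_Spaces.linear pm_scale s' "lin_ext s' (\<lambda>(a, b). \<beta> a b)"
    by (rule linear_lin_ext[OF V])
  note lin = Vector_Spaces.linear.axioms(3)[OF l] Vector_Spaces.linear.axioms(3)[OF r]
  from u show ?thesis
    unfolding tensor2_null_def
  proof (induction rule: L.vs1.span_induct_alt)
    case base
    show ?case by (rule L.zero)
  next
    case (step c x y)
    have "lin_ext s' (\<lambda>(a, b). \<beta> a b) x = 0"
      using step(1) lin[THEN module_hom.add] lin[THEN module_hom.scale]
      by (auto simp: L.diff L.scale lin_ext_basis_vec[OF V])
    then show ?case
      using step(2) by (simp add: L.add L.scale)
  qed
qed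

lemma tensor2_lift_pure:
  assumes V: "vector_space s'"
    and l: "\<And>b. Vector_Spaces.linear s s' (\<lambda>a. \<beta> a b)"
    and r: "\<And>a. Vector_Spaces.linear s s' (\<beta> a)"
  shows "tensor2_lift s' \<beta> (tensor2_pure s a b) = \<beta> a b"
proof -
  interpret L: Vector_Spaces.linear pm_scale s' "lin_ext s' (\<lambda>(a, b). \<beta> a b)"
    by (rule linear_lin_ext[OF V])
  have "basis_vec (a, b) \<in> tensor2_pure s a b"
    by (simp add: tensor2_pure_def coset_def tensor2_null_def L.vs1.span_zero)
  then have "rep (tensor2_pure s a b) \<in> tensor2_pure s a b"
    unfolding rep_def by (rule someI)
  then have "rep (tensor2_pure s a b) - basis_vec (a, b) \<in> tensor2_null s"
    by (simp add: tensor2_pure_def coset_def)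
  from lin_ext_tensor2_null[where \<beta> = \<beta>, OF V l r this] show ?thesis
    by (simp add: tensor2_lift_def L.diff lin_ext_basis_vec[OF V])
qed

text \<open>\<open>\<Delta> \<otimes> id\<close> and \<open>id \<otimes> \<Delta>\<close> as maps \<open>A \<otimes> A \<rightarrow> A \<otimes> A \<otimes> A\<close>, for \<open>\<Delta> : A \<rightarrow> A \<otimes> A\<close>.\<close>

definition coprod_id ::
  "('k::field \<Rightarrow> 'a::ab_group_add \<Rightarrow> 'a) \<Rightarrow> ('a \<Rightarrow> ('k, 'a) tensor2) \<Rightarrow>
   ('k, 'a) tensor2 \<Rightarrow> ('k, 'a) tensor3" where
  "coprod_id s D U = coset (tensor3_null s)
     (lin_ext pm_scale
        (\<lambda>(a, b). lin_ext pm_scale (\<lambda>(p, q). basis_vec (p, q, b)) (rep (D a))) (rep U))"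

definition id_coprod ::
  "('k::field \<Rightarrow> 'a::ab_group_add \<Rightarrow> 'a) \<Rightarrow> ('a \<Rightarrow> ('k, 'a) tensor2) \<Rightarrow>
   ('k, 'a) tensor2 \<Rightarrow> ('k, 'a) tensor3" where
  "id_coprod s D U = coset (tensor3_null s)
     (lin_ext pm_scale
        (\<lambda>(a, b). lin_ext pm_scale (\<lambda>(p, q). basis_vec (a, p, q)) (rep (D b))) (rep U))"


section \<open>Infinitesimal unitary bialgebras and Hopf algebras\<close>

text \<open>The underlying vector space of a structure is the whole type \<open>'a\<close>. Multiplication and unit
  are explicit fields (rather than those of a type class of unital rings) so that the zero algebra
  is not excluded.\<close>

record (overloaded) ('k, 'a) eps_alg =
  scal :: "'k \<Rightarrow> 'a \<Rightarrow> 'a"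
  mul :: "'a \<Rightarrow> 'a \<Rightarrow> 'a"
  one_el :: 'a
  coprod :: "'a \<Rightarrow> ('k, 'a) tensor2"

record (overloaded) ('k, 'a) operated_eps_alg = "('k, 'a) eps_alg" +
  oper :: "'a \<Rightarrow> 'a"

locale unitary_algebra = vector_space "scal A"
  for A :: "('k::field_char_0, 'a::ab_group_add, 'z) eps_alg_scheme" +
  assumes mul_linear_left: "\<And>b. Vector_Spaces.linear (scal A) (scal A) (\<lambda>a. mul A a b)"
    and mul_linear_right: "\<And>a. Vector_Spaces.linear (scal A) (scal A) (mul A a)"
    and mul_assoc: "\<And>a b c. mul A (mul A a b) c = mul A a (mul A b c)"
    and mul_one_left: "\<And>a. mul A (one_el A) a = a"
    and mul_one_right: "\<And>a. mul A a (one_el A) = a"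

locale coassociative_coalgebra = vector_space "scal A"
  for A :: "('k::field_char_0, 'a::ab_group_add, 'z) eps_alg_scheme" +
  assumes coprod_in: "\<And>a. coprod A a \<in> tensor2_space (scal A)"
    and coprod_add: "\<And>a b. coprod A (a + b) = tensor2_add (scal A) (coprod A a) (coprod A b)"
    and coprod_scale: "\<And>c a. coprod A (scal A c a) = tensor2_scale (scal A) c (coprod A a)"
    and coassoc: "\<And>a. coprod_id (scal A) (coprod A) (coprod A a)
                     = id_coprod (scal A) (coprod A) (coprod A a)"

text \<open>The bimodule actions \<open>a \<cdot> (b \<otimes> c) = ab \<otimes> c\<close> and \<open>(b \<otimes> c) \<cdot> a = b \<otimes> ca\<close>.\<close>

definition act_left ::
  "('k::field, 'a::ab_group_add, 'z) eps_alg_scheme \<Rightarrow> 'a \<Rightarrow> ('k, 'a) tensor2 \<Rightarrow> ('k, 'a) tensor2"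
  where "act_left A a U = tensor2_map (scal A) (\<lambda>b. mul A a b) (\<lambda>c. c) U"

definition act_right ::
  "('k::field, 'a::ab_group_add, 'z) eps_alg_scheme \<Rightarrow> ('k, 'a) tensor2 \<Rightarrow> 'a \<Rightarrow> ('k, 'a) tensor2"
  where "act_right A U a = tensor2_map (scal A) (\<lambda>b. b) (\<lambda>c. mul A c a) U"

locale eps_bialgebra = unitary_algebra A + coassociative_coalgebra A
  for A :: "('k::field_char_0, 'a::ab_group_add, 'z) eps_alg_scheme" +
  assumes coprod_mul: "\<And>a b. coprod A (mul A a b) =
    tensor2_add (scal A) (act_left A a (coprod A b)) (act_right A (coprod A a) b)"

definition eps_bialgebra_hom ::
  "('k::field_char_0, 'a::ab_group_add, 'y) eps_alg_scheme \<Rightarrow>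
   ('k, 'b::ab_group_add, 'z) eps_alg_scheme \<Rightarrow> ('a \<Rightarrow> 'b) \<Rightarrow> bool" where
  "eps_bialgebra_hom A B \<phi> \<longleftrightarrow>
     Vector_Spaces.linear (scal A) (scal B) \<phi> \<and>
     (\<forall>a b. \<phi> (mul A a b) = mul B (\<phi> a) (\<phi> b)) \<and>
     \<phi> (one_el A) = one_el B \<and>
     (\<forall>a. coprod B (\<phi> a) = tensor2_map (scal B) \<phi> \<phi> (coprod A a))"

definition convolution ::
  "('k::field, 'a::ab_group_add, 'z) eps_alg_scheme \<Rightarrow> ('a \<Rightarrow> 'a) \<Rightarrow> ('a \<Rightarrow> 'a) \<Rightarrow> 'a \<Rightarrow> 'a" where
  "convolution A f g a = tensor2_lift (scal A) (mul A) (tensor2_map (scal A) f g (coprod A a))"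

definition circ_convolution ::
  "('k::field, 'a::ab_group_add, 'z) eps_alg_scheme \<Rightarrow> ('a \<Rightarrow> 'a) \<Rightarrow> ('a \<Rightarrow> 'a) \<Rightarrow> 'a \<Rightarrow> 'a" where
  "circ_convolution A f g a = convolution A f g a + f a + g a"

text \<open>The unit of the circular convolution is the zero map.\<close>

definition is_antipode ::
  "('k::field, 'a::ab_group_add, 'z) eps_alg_scheme \<Rightarrow> ('a \<Rightarrow> 'a) \<Rightarrow> bool" where
  "is_antipode A S \<longleftrightarrow>
     Vector_Spaces.linear (scal A) (scal A) S \<and>
     circ_convolution A S (\<lambda>a. a) = (\<lambda>a. 0) \<and>
     circ_convolution A (\<lambda>a. a) S = (\<lambda>a. 0)"

definition antipode :: "('k::field, 'a::ab_group_add, 'z) eps_alg_scheme \<Rightarrow> 'a \<Rightarrow> 'a" where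
  "antipode A = (THE S. is_antipode A S)"

locale eps_hopf_algebra = eps_bialgebra A
  for A :: "('k::field_char_0, 'a::ab_group_add, 'z) eps_alg_scheme" +
  assumes antipode_exists: "\<exists>S. is_antipode A S"

definition eps_hopf_hom ::
  "('k::field_char_0, 'a::ab_group_add, 'y) eps_alg_scheme \<Rightarrow>
   ('k, 'b::ab_group_add, 'z) eps_alg_scheme \<Rightarrow> ('a \<Rightarrow> 'b) \<Rightarrow> bool" where
  "eps_hopf_hom H L \<phi> \<longleftrightarrow>
     eps_bialgebra_hom H L \<phi> \<and> (\<forall>a. antipode L (\<phi> a) = \<phi> (antipode H a))"

locale operated_eps_hopf_algebra = eps_hopf_algebra H
  for H :: "('k::field_char_0, 'a::ab_group_add, 'z) operated_eps_alg_scheme" +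
  assumes oper_linear: "Vector_Spaces.linear (scal H) (scal H) (oper H)"

definition operated_eps_hopf_hom ::
  "('k::field_char_0, 'a::ab_group_add, 'y) operated_eps_alg_scheme \<Rightarrow>
   ('k, 'b::ab_group_add, 'z) operated_eps_alg_scheme \<Rightarrow> ('a \<Rightarrow> 'b) \<Rightarrow> bool" where
  "operated_eps_hopf_hom H L \<phi> \<longleftrightarrow>
     eps_hopf_hom H L \<phi> \<and> (\<forall>a. \<phi> (oper H a) = oper L (\<phi> a))"

locale cocycle_eps_hopf_algebra = operated_eps_hopf_algebra H
  for H :: "('k::field_char_0, 'a::ab_group_add, 'z) operated_eps_alg_scheme" +
  assumes cocycle: "\<And>a. coprod H (oper H a) =
    tensor2_add (scal H) (tensor2_pure (scal H) a (one_el H))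
      (tensor2_map (scal H) (\<lambda>b. b) (oper H) (coprod H a))"


section \<open>Universal properties\<close>

text \<open>A formula cannot quantify over types, so both notions take as an argument the type \<open>'h\<close> on
  which the target structures live. A statement in which \<open>'h\<close> is a free type variable covers all
  target structures.\<close>

definition free_cocycle_eps_hopf_algebra ::
  "'x set \<Rightarrow> ('x \<Rightarrow> 'a) \<Rightarrow> ('k::field_char_0, 'a::ab_group_add) operated_eps_alg \<Rightarrow>
   'h::ab_group_add itself \<Rightarrow> bool" where
  "free_cocycle_eps_hopf_algebra X j HX (_ :: 'h itself) \<longleftrightarrow>
     cocycle_eps_hopf_algebra HX \<and>
     (\<forall>(H :: ('k, 'h) operated_eps_alg) (f :: 'x \<Rightarrow> 'h).
        cocycle_eps_hopf_algebra H \<and>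
        (\<forall>x\<in>X. coprod H (f x) = tensor2_pure (scal H) (one_el H) (one_el H)) \<longrightarrow>
        (\<exists>!\<phi>. operated_eps_hopf_hom HX H \<phi> \<and> (\<forall>x\<in>X. \<phi> (j x) = f x)))"

definition initial_cocycle_eps_hopf_algebra ::
  "('k::field_char_0, 'a::ab_group_add) operated_eps_alg \<Rightarrow> 'h::ab_group_add itself \<Rightarrow> bool" where
  "initial_cocycle_eps_hopf_algebra I (_ :: 'h itself) \<longleftrightarrow>
     cocycle_eps_hopf_algebra I \<and>
     (\<forall>H :: ('k, 'h) operated_eps_alg.
        cocycle_eps_hopf_algebra H \<longrightarrow> (\<exists>!\<phi>. operated_eps_hopf_hom I H \<phi>))"


section \<open>Planar rooted forests\<close>

text \<open>\<open>Node F\<close> is the tree obtained by grafting the forest \<open>F\<close> onto a new root. The list type makes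
  forests the free monoid on the nonempty trees; the empty tree \<open>1\<close> is the empty list.\<close>

datatype rtree = Node "rtree list"

type_synonym forest = "rtree list"

definition forest_mul ::
  "(forest \<Rightarrow>\<^sub>0 'k::field) \<Rightarrow> (forest \<Rightarrow>\<^sub>0 'k) \<Rightarrow> (forest \<Rightarrow>\<^sub>0 'k)" where
  "forest_mul u v = lin_ext pm_scale (\<lambda>F. lin_ext pm_scale (\<lambda>G. basis_vec (F @ G)) v) u"

definition forest_one :: "forest \<Rightarrow>\<^sub>0 'k::field" where
  "forest_one = basis_vec []"

definition B_plus :: "(forest \<Rightarrow>\<^sub>0 'k::field) \<Rightarrow> (forest \<Rightarrow>\<^sub>0 'k)" where
  "B_plus u = lin_ext pm_scale (\<lambda>F. basis_vec [Node F]) u"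

text \<open>\<open>\<Delta>\<^sub>\<epsilon>\<close> on the basis of forests. In the last clause the two \<open>tensor2_map\<close> terms are
  \<open>T \<cdot> \<Delta>\<^sub>\<epsilon>(T' Ts)\<close> and \<open>\<Delta>\<^sub>\<epsilon>(T) \<cdot> (T' Ts)\<close>.\<close>

fun eps_coprod_forest :: "forest \<Rightarrow> ('k::field, forest \<Rightarrow>\<^sub>0 'k) tensor2" where
  "eps_coprod_forest [] = tensor2_zero pm_scale"
| "eps_coprod_forest [Node F] =
     tensor2_add pm_scale (tensor2_pure pm_scale (basis_vec F) forest_one)
       (tensor2_map pm_scale (\<lambda>u. u) B_plus (eps_coprod_forest F))"
| "eps_coprod_forest (T # T' # Ts) =
     tensor2_add pm_scale
       (tensor2_map pm_scale (\<lambda>u. forest_mul (basis_vec [T]) u) (\<lambda>v. v)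
          (eps_coprod_forest (T' # Ts)))
       (tensor2_map pm_scale (\<lambda>u. u) (\<lambda>v. forest_mul v (basis_vec (T' # Ts)))
          (eps_coprod_forest [T]))"

text \<open>Its linear extension to \<open>k\<F>\<close>, with the linear combination formed on representatives.\<close>

definition eps_coprod :: "(forest \<Rightarrow>\<^sub>0 'k::field) \<Rightarrow> ('k, forest \<Rightarrow>\<^sub>0 'k) tensor2" where
  "eps_coprod u =
     coset (tensor2_null pm_scale) (lin_ext pm_scale (\<lambda>F. rep (eps_coprod_forest F)) u)"

definition forest_hopf :: "('k::field, forest \<Rightarrow>\<^sub>0 'k) operated_eps_alg" where
  "forest_hopf = \<lparr>scal = pm_scale, mul = forest_mul, one_el = forest_one,
     coprod = eps_coprod, oper = B_plus\<rparr>"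

end

theory Submission
  imports Defs
begin

text \<open>On a forest \<open>F\<close> the coproduct is a sum \<open>\<Sum> a \<otimes> b\<close> of pairs of forests, one pair for each vertex of
  \<open>F\<close>. Coassociativity, the derivation rule and the cocycle condition are then identities between
  such finite sums. Since \<open>a\<close> and \<open>b\<close> have fewer vertices than \<open>F\<close>, the inverse of the identity
  for the circular convolution can be solved for recursively.

  Every nonempty forest is uniquely \<open>B\<^sup>+(F) G\<close>, so the only possible morphism to \<open>(H, P)\<close> is the
  linear extension of \<open>\<phi>(B\<^sup>+(F) G) = P(\<phi>(F)) \<phi>(G)\<close>, \<open>\<phi>(1) = 1\<close>. It respects the coproducts by the
  derivation rule and the cocycle condition in \<open>H\<close>, together with \<open>\<Delta>(1) = 0\<close>, which follows from
  \<open>1 \<cdot> 1 = 1\<close>. It commutes with the antipodes because \<open>S\<^sub>H \<circ> \<phi>\<close> and \<open>\<phi> \<circ> S\<close> are both inverse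
  to \<open>\<phi>\<close> for the circular convolution of maps from forests to \<open>H\<close>.\<close>

section \<open>Linear extensions\<close>

interpretation pm: vector_space "pm_scale :: 'k::field \<Rightarrow> ('x \<Rightarrow>\<^sub>0 'k) \<Rightarrow> ('x \<Rightarrow>\<^sub>0 'k)"
  by (rule vector_space_pm_scale)

lemma linearI:
  assumes "vector_space s" "vector_space t"
    and "\<And>x y. f (x + y) = f x + f y" "\<And>c x. f (s c x) = t c (f x)"
  shows "Vector_Spaces.linear s t f"
proof -
  interpret A: vector_space s by fact
  interpret B: vector_space t by fact
  show ?thesis by unfold_locales (use assms in auto)
qed

lemma
  assumes "Vector_Spaces.linear s t f"
  shows linear_vs1: "vector_space s" and linear_vs2: "vector_space t"
    and linear_add': "f (x + y) = f x + f y"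
    and linear_scale': "f (s c x) = t c (f x)"
    and linear_zero': "f 0 = 0"
    and linear_diff': "f (x - y) = f x - f y"
proof -
  interpret Vector_Spaces.linear s t f by fact
  show "vector_space s" "vector_space t" by unfold_locales
  show "f (x + y) = f x + f y" "f (s c x) = t c (f x)" "f 0 = 0" "f (x - y) = f x - f y"
    by (rule add scale zero diff)+
qed

lemma linear_sum_list:
  assumes "Vector_Spaces.linear s t f"
  shows "f (\<Sum>x\<leftarrow>xs. g x) = (\<Sum>x\<leftarrow>xs. f (g x))"
  by (induction xs) (simp_all add: linear_add'[OF assms] linear_zero'[OF assms])

lemma linear_comp:
  assumes "Vector_Spaces.linear s t f" "Vector_Spaces.linear t w g"
  shows "Vector_Spaces.linear s w (\<lambda>x. g (f x))"
  using assms
  by (intro linearI) (auto simp: linear_vs1 linear_vs2 linear_add' linear_scale')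

lemma linear_ident': "vector_space s \<Longrightarrow> Vector_Spaces.linear s s (\<lambda>x. x)"
  by (rule linearI) auto

lemmas lin_ext_add = linear_lin_ext[THEN linear_add']
  and lin_ext_scale = linear_lin_ext[THEN linear_scale']
  and lin_ext_zero = linear_lin_ext[THEN linear_zero']
  and lin_ext_diff = linear_lin_ext[THEN linear_diff']
  and lin_ext_sum_list = linear_lin_ext[THEN linear_sum_list]

lemma linear_apply_lin_ext:
  assumes "Vector_Spaces.linear s t h"
  shows "h (lin_ext s f u) = lin_ext t (\<lambda>x. h (f x)) u"
proof -
  interpret Vector_Spaces.linear s t h by fact
  show ?thesis by (simp add: lin_ext_def sum scale)
qed

lemma lin_ext_lin_ext:
  assumes "vector_space s"
  shows "lin_ext s f (lin_ext pm_scale g u) = lin_ext s (\<lambda>x. lin_ext s f (g x)) u"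
  by (rule linear_apply_lin_ext[OF linear_lin_ext[OF assms]])

lemma lin_ext_basis_vec_id: "lin_ext pm_scale basis_vec u = u"
proof (rule poly_mapping_eqI)
  fix k
  have "Poly_Mapping.lookup (lin_ext pm_scale basis_vec u) k
      = (\<Sum>x\<in>Poly_Mapping.keys u. Poly_Mapping.lookup u x * (if x = k then 1 else 0))"
    unfolding lin_ext_def lookup_sum
    by (intro sum.cong) (auto simp: basis_vec_def lookup_single)
  then show "Poly_Mapping.lookup (lin_ext pm_scale basis_vec u) k = Poly_Mapping.lookup u k"
    by (simp add: if_distrib[of "(*) _"] sum.delta in_keys_iff split: if_splits cong: if_cong)
qed

lemma linear_eq_lin_ext:
  assumes "Vector_Spaces.linear pm_scale s f"
  shows "f u = lin_ext s (\<lambda>x. f (basis_vec x)) u"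
  using linear_apply_lin_ext[OF assms, of basis_vec u] by (simp add: lin_ext_basis_vec_id)

lemma linear_eqI_basis:
  assumes "Vector_Spaces.linear pm_scale s f" "Vector_Spaces.linear pm_scale s g"
    and "\<And>x. f (basis_vec x) = g (basis_vec x)"
  shows "f u = g u"
  using assms linear_eq_lin_ext[of s f u] linear_eq_lin_ext[of s g u] by simp

lemma
  assumes "vector_space s"
  shows lin_ext_fun_add: "lin_ext s (\<lambda>x. f x + g x) u = lin_ext s f u + lin_ext s g u"
    and lin_ext_fun_diff: "lin_ext s (\<lambda>x. f x - g x) u = lin_ext s f u - lin_ext s g u"
    and lin_ext_fun_scale: "lin_ext s (\<lambda>x. s c (f x)) u = s c (lin_ext s f u)"
proof -
  interpret vector_space s by fact
  show "lin_ext s (\<lambda>x. f x + g x) u = lin_ext s f u + lin_ext s g u"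
    by (simp add: lin_ext_def scale_right_distrib sum.distrib)
  show "lin_ext s (\<lambda>x. f x - g x) u = lin_ext s f u - lin_ext s g u"
    by (simp add: lin_ext_def scale_right_diff_distrib sum_subtractf)
  show "lin_ext s (\<lambda>x. s c (f x)) u = s c (lin_ext s f u)"
    by (simp add: lin_ext_def scale_sum_right mult.commute)
qed

lemma linear_fun_lin_ext:
  assumes "vector_space t" "\<And>x. Vector_Spaces.linear s t (\<lambda>a. \<beta> a x)"
  shows "Vector_Spaces.linear s t (\<lambda>a. lin_ext t (\<beta> a) u)"
proof (rule linearI)
  have "\<beta> (x + y) = (\<lambda>z. \<beta> x z + \<beta> y z)" "\<beta> (s c x) = (\<lambda>z. t c (\<beta> x z))" for x y c
    by (auto simp: linear_add'[OF assms(2)] linear_scale'[OF assms(2)])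
  then show "lin_ext t (\<beta> (x + y)) u = lin_ext t (\<beta> x) u + lin_ext t (\<beta> y) u"
    "lin_ext t (\<beta> (s c x)) u = t c (lin_ext t (\<beta> x) u)" for x y c
    by (simp_all add: lin_ext_fun_add[OF assms(1)] lin_ext_fun_scale[OF assms(1)])
qed (use assms(1) linear_vs1[OF assms(2)] in auto)


section \<open>Linearity modulo a subspace\<close>

text \<open>Since quotients are not types here, a linear map into \<open>V / N\<close> is handled through a set-theoretic
  lift to \<open>V\<close> that is linear up to elements of \<open>N\<close>.\<close>

definition lin_mod ::
  "('x \<Rightarrow>\<^sub>0 'k::field) set \<Rightarrow> ('k \<Rightarrow> 'a::ab_group_add \<Rightarrow> 'a) \<Rightarrow> ('a \<Rightarrow> ('x \<Rightarrow>\<^sub>0 'k)) \<Rightarrow> bool" where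
  "lin_mod N s f \<longleftrightarrow>
     (\<forall>a b. f (a + b) - (f a + f b) \<in> N) \<and> (\<forall>c a. f (s c a) - pm_scale c (f a) \<in> N)"

lemma coset_eq_iff:
  assumes "pm.subspace N"
  shows "coset N u = coset N v \<longleftrightarrow> u - v \<in> N"
proof
  have "u \<in> coset N u" using pm.subspace_0[OF assms] by (simp add: coset_def)
  also assume "coset N u = coset N v"
  finally show "u - v \<in> N" by (simp add: coset_def)
next
  assume uv: "u - v \<in> N"
  have "w - u \<in> N \<longleftrightarrow> w - v \<in> N" for w
  proof
    assume "w - u \<in> N"
    from pm.subspace_add[OF assms this uv] show "w - v \<in> N" by (simp only: diff_add_cancel add_diff_eq)
  next
    assume "w - v \<in> N"
    from pm.subspace_diff[OF assms this uv] show "w - u \<in> N" by (simp only: diff_diff_eq2 diff_add_cancel)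
  qed
  then show "coset N u = coset N v" unfolding coset_def by (simp only:)
qed

lemma rep_coset:
  assumes "pm.subspace N"
  shows "rep (coset N u) - u \<in> N"
proof -
  have "u \<in> coset N u" using pm.subspace_0[OF assms] by (simp add: coset_def)
  then have "rep (coset N u) \<in> coset N u" unfolding rep_def by (rule someI)
  then show ?thesis by (simp add: coset_def)
qed

lemma coset_rep: "pm.subspace N \<Longrightarrow> coset N (rep (coset N u)) = coset N u"
  by (simp add: coset_eq_iff rep_coset)

lemma lin_ext_in_subspace:
  assumes "pm.subspace N" "\<And>x. f x \<in> N"
  shows "lin_ext pm_scale f u \<in> N"
  unfolding lin_ext_def by (intro pm.subspace_sum[OF assms(1)] pm.subspace_scale[OF assms(1)] assms(2))

lemma lin_ext_cong_mod:
  assumes "pm.subspace N" "\<And>x. f x - g x \<in> N"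
  shows "lin_ext pm_scale f u - lin_ext pm_scale g u \<in> N"
  using lin_ext_in_subspace[OF assms, where u = u] by (simp add: lin_ext_fun_diff[OF vector_space_pm_scale])

lemma lin_mod_lin_ext:
  assumes N: "pm.subspace N" and s: "vector_space s" and f: "lin_mod N s f"
  shows "f (lin_ext s g u) - lin_ext pm_scale (\<lambda>x. f (g x)) u \<in> N"
proof -
  interpret vector_space s by fact
  have add: "f (a + b) - (f a + f b) \<in> N" and sc: "f (s c a) - pm_scale c (f a) \<in> N" for a b c
    using f by (auto simp: lin_mod_def)
  \<comment> \<open>Scaling by 0 forces this; it is the empty sum that starts the induction
    below.\<close>
  have f0: "f 0 \<in> N"
    using sc[of 0 0] by simp
  \<comment> \<open>The support and the coefficients are generalised to an arbitrary finite
    \<open>K\<close> and an arbitrary \<open>c\<close>, so that induction on \<open>K\<close>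
    applies.\<close>
  have "f (\<Sum>x\<in>K. s (c x) (g x)) - (\<Sum>x\<in>K. pm_scale (c x) (f (g x))) \<in> N" if "finite K" for K c
    using that
  proof induction
    case (insert x K)
    from pm.subspace_add[OF N pm.subspace_add[OF N insert(3) sc[of "c x" "g x"]]
        add[of "s (c x) (g x)" "\<Sum>x\<in>K. s (c x) (g x)"]]
    show ?case using insert(1,2) by (simp add: algebra_simps)
  qed (simp add: f0)
  from this[OF finite_keys] show ?thesis unfolding lin_ext_def .
qed

lemma lin_mod_comp:
  assumes "lin_mod N t f" "Vector_Spaces.linear s t g"
  shows "lin_mod N s (\<lambda>a. f (g a))"
  using assms by (simp add: lin_mod_def linear_add' linear_scale')

lemma lin_mod_linear_comp:
  assumes f: "lin_mod N s f" and h: "Vector_Spaces.linear pm_scale pm_scale h"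
    and "\<And>u. u \<in> N \<Longrightarrow> h u \<in> N'"
  shows "lin_mod N' s (\<lambda>a. h (f a))"
proof -
  have "h (f (a + b) - (f a + f b)) \<in> N'" "h (f (s c a) - pm_scale c (f a)) \<in> N'" for a b c
    using f assms(3) by (auto simp: lin_mod_def)
  then show ?thesis
    by (simp add: lin_mod_def linear_diff'[OF h] linear_add'[OF h] linear_scale'[OF h])
qed

lemma lin_mod_fun_lin_ext:
  assumes N: "pm.subspace N" and f: "\<And>x. lin_mod N s (\<lambda>a. f a x)"
  shows "lin_mod N s (\<lambda>a. lin_ext pm_scale (f a) u)"
  unfolding lin_mod_def
proof (intro conjI allI)
  fix a b c
  have "lin_ext pm_scale (f (a + b)) u - lin_ext pm_scale (\<lambda>x. f a x + f b x) u \<in> N"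
    by (rule lin_ext_cong_mod[OF N]) (use f in \<open>auto simp: lin_mod_def\<close>)
  then show "lin_ext pm_scale (f (a + b)) u - (lin_ext pm_scale (f a) u + lin_ext pm_scale (f b) u) \<in> N"
    by (simp add: lin_ext_fun_add[OF vector_space_pm_scale])
  have "lin_ext pm_scale (f (s c a)) u - lin_ext pm_scale (\<lambda>x. pm_scale c (f a x)) u \<in> N"
    by (rule lin_ext_cong_mod[OF N]) (use f in \<open>auto simp: lin_mod_def\<close>)
  then show "lin_ext pm_scale (f (s c a)) u - pm_scale c (lin_ext pm_scale (f a) u) \<in> N"
    by (simp add: lin_ext_fun_scale[OF vector_space_pm_scale])
qed


section \<open>Tensor powers\<close>

lemma subspace_tensor2_null: "pm.subspace (tensor2_null s)"
  unfolding tensor2_null_def by (rule pm.subspace_span)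

lemma subspace_tensor3_null: "pm.subspace (tensor3_null s)"
  unfolding tensor3_null_def by (rule pm.subspace_span)

text \<open>The required differences are the generators of \<open>tensor2_null\<close> themselves,
  once \<open>x - (y + z)\<close> is rewritten as \<open>x - y - z\<close>.\<close>

lemma lin_mod_pure:
  shows lin_mod_pure_left: "lin_mod (tensor2_null s) s (\<lambda>a. basis_vec (a, b))"
    and lin_mod_pure_right: "lin_mod (tensor2_null s) s (\<lambda>b. basis_vec (a, b))"
  unfolding lin_mod_def tensor2_null_def
  unfolding diff_diff_eq[symmetric] by (intro conjI allI; rule pm.span_base; blast)+

lemma lin_mod_pure3:
  shows lin_mod_pure3_1: "lin_mod (tensor3_null s) s (\<lambda>a. basis_vec (a, b, d))"
    and lin_mod_pure3_2: "lin_mod (tensor3_null s) s (\<lambda>b. basis_vec (a, b, d))"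
    and lin_mod_pure3_3: "lin_mod (tensor3_null s) s (\<lambda>d. basis_vec (a, b, d))"
proof -
  have add: "basis_vec (x + y, b, d) - basis_vec (x, b, d) - basis_vec (y, b, d) \<in> tensor3_null s"
    "basis_vec (a, x + y, d) - basis_vec (a, x, d) - basis_vec (a, y, d) \<in> tensor3_null s"
    "basis_vec (a, b, x + y) - basis_vec (a, b, x) - basis_vec (a, b, y) \<in> tensor3_null s"
    and scale: "basis_vec (s c x, b, d) - pm_scale c (basis_vec (x, b, d)) \<in> tensor3_null s"
    "basis_vec (a, s c x, d) - pm_scale c (basis_vec (a, x, d)) \<in> tensor3_null s"
    "basis_vec (a, b, s c x) - pm_scale c (basis_vec (a, b, x)) \<in> tensor3_null s"
    for a b c d x y
    unfolding tensor3_null_def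
    by (rule pm.span_base, (rule UnI2, fast | rule UnI1)+, fast?)+
  show "lin_mod (tensor3_null s) s (\<lambda>a. basis_vec (a, b, d))"
    "lin_mod (tensor3_null s) s (\<lambda>b. basis_vec (a, b, d))"
    "lin_mod (tensor3_null s) s (\<lambda>d. basis_vec (a, b, d))"
    by (simp_all only: lin_mod_def add scale diff_diff_eq[symmetric] simp_thms)
qed

text \<open>Bilinearity modulo \<open>N\<close> says exactly that each generator of the relations
  lands in \<open>N\<close>. Unlike \<open>lin_ext_tensor2_null\<close>, this covers maps whose
  values are themselves representatives of tensors.\<close>

lemma lin_ext_tensor2_null_mod:
  assumes N: "pm.subspace N"
    and l: "\<And>b. lin_mod N s (\<lambda>a. \<beta> a b)" and r: "\<And>a. lin_mod N s (\<beta> a)"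
    and u: "u \<in> tensor2_null s"
  shows "lin_ext pm_scale (\<lambda>(a, b). \<beta> a b) u \<in> N"
  using u unfolding tensor2_null_def
proof (induction rule: pm.span_induct_alt)
  case base
  show ?case by (simp add: lin_ext_zero[OF vector_space_pm_scale] pm.subspace_0[OF N])
next
  case (step c x y)
  have "lin_ext pm_scale (\<lambda>(a, b). \<beta> a b) x \<in> N"
    using step(1) l r unfolding lin_mod_def
    by (auto simp: lin_ext_diff[OF vector_space_pm_scale] lin_ext_scale[OF vector_space_pm_scale]
        lin_ext_basis_vec[OF vector_space_pm_scale] lin_ext_add[OF vector_space_pm_scale] diff_diff_eq)
  then show ?case
    using step(2)
    by (simp add: lin_ext_add[OF vector_space_pm_scale] lin_ext_scale[OF vector_space_pm_scale]
        pm.subspace_add[OF N] pm.subspace_scale[OF N])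
qed

lemma lin_ext_tensor3_null:
  assumes V: "vector_space s'"
    and 1: "\<And>b d. Vector_Spaces.linear s s' (\<lambda>a. \<beta> a b d)"
    and 2: "\<And>a d. Vector_Spaces.linear s s' (\<lambda>b. \<beta> a b d)"
    and 3: "\<And>a b. Vector_Spaces.linear s s' (\<lambda>d. \<beta> a b d)"
    and u: "u \<in> tensor3_null s"
  shows "lin_ext s' (\<lambda>(a, b, d). \<beta> a b d) u = 0"
  using u unfolding tensor3_null_def
proof (induction rule: pm.span_induct_alt)
  case base
  show ?case by (rule lin_ext_zero[OF V])
next
  case (step c x y)
  interpret vector_space s' by fact
  have "lin_ext s' (\<lambda>(a, b, d). \<beta> a b d) x = 0"
    using step(1) linear_add'[OF 1] linear_add'[OF 2] linear_add'[OF 3]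
      linear_scale'[OF 1] linear_scale'[OF 2] linear_scale'[OF 3]
    by (auto simp: lin_ext_diff[OF V] lin_ext_scale[OF V] lin_ext_basis_vec[OF V])
  then show ?case
    using step(2) by (simp add: lin_ext_add[OF V] lin_ext_scale[OF V])
qed

text \<open>This rule and its companions ending in \<open>_coset\<close> allow tensor operations to
  be computed on whichever representative is at hand. Changing the representative alters the outcome
  by a relation at most.\<close>

lemma tensor2_add_coset:
  "tensor2_add s (coset (tensor2_null s) u) (coset (tensor2_null s) v)
     = coset (tensor2_null s) (u + v)"
  using pm.subspace_add[OF subspace_tensor2_null rep_coset[OF subspace_tensor2_null, of s u]
      rep_coset[OF subspace_tensor2_null, of s v]]
  by (simp add: tensor2_add_def coset_eq_iff[OF subspace_tensor2_null] algebra_simps)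

lemma tensor2_scale_coset:
  "tensor2_scale s c (coset (tensor2_null s) u) = coset (tensor2_null s) (pm_scale c u)"
  using pm.subspace_scale[OF subspace_tensor2_null rep_coset[OF subspace_tensor2_null, of s u], of c]
  by (simp add: tensor2_scale_def coset_eq_iff[OF subspace_tensor2_null] pm.scale_right_diff_distrib)

lemma tensor2_map_null:
  assumes "Vector_Spaces.linear s t f" "Vector_Spaces.linear s t g" "u \<in> tensor2_null s"
  shows "lin_ext pm_scale (\<lambda>(a, b). basis_vec (f a, g b)) u \<in> tensor2_null t"
  by (rule lin_ext_tensor2_null_mod[OF subspace_tensor2_null _ _ assms(3)])
     (rule lin_mod_comp[OF lin_mod_pure_left assms(1)] lin_mod_comp[OF lin_mod_pure_right assms(2)])+

lemma tensor2_map_coset: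
  assumes "Vector_Spaces.linear s t f" "Vector_Spaces.linear s t g"
  shows "tensor2_map t f g (coset (tensor2_null s) u)
    = coset (tensor2_null t) (lin_ext pm_scale (\<lambda>(a, b). basis_vec (f a, g b)) u)"
  using tensor2_map_null[OF assms rep_coset[OF subspace_tensor2_null]]
  by (simp add: tensor2_map_def coset_eq_iff[OF subspace_tensor2_null]
      lin_ext_diff[OF vector_space_pm_scale])

lemma tensor2_lift_coset:
  assumes V: "vector_space s'"
    and "\<And>b. Vector_Spaces.linear s s' (\<lambda>a. \<beta> a b)" "\<And>a. Vector_Spaces.linear s s' (\<beta> a)"
  shows "tensor2_lift s' \<beta> (coset (tensor2_null s) u) = lin_ext s' (\<lambda>(a, b). \<beta> a b) u"
  using lin_ext_tensor2_null[where \<beta> = \<beta>, OF assms rep_coset[OF subspace_tensor2_null]]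
  by (simp add: tensor2_lift_def lin_ext_diff[OF V])

lemma lin_ext_pure3_null:
  assumes "u \<in> tensor2_null s"
  shows "lin_ext pm_scale (\<lambda>(p, q). basis_vec (p, q, b)) u \<in> tensor3_null s"
    and "lin_ext pm_scale (\<lambda>(p, q). basis_vec (a, p, q)) u \<in> tensor3_null s"
  by (rule lin_ext_tensor2_null_mod[OF subspace_tensor3_null _ _ assms] lin_mod_pure3)+

text \<open>The summand is bilinear modulo three-fold relations: in \<open>a\<close> because pure
  triple tensors are, and in \<open>b\<close> because \<open>rep (D b)\<close> is linear modulo
  two-fold relations, which placing \<open>a\<close> in front turns into three-fold ones.\<close>

lemma id_coprod_coset:
  assumes "lin_mod (tensor2_null s) s (\<lambda>a. rep (D a))"
  shows "id_coprod s D (coset (tensor2_null s) u) = coset (tensor3_null s)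
     (lin_ext pm_scale (\<lambda>(a, b). lin_ext pm_scale (\<lambda>(p, q). basis_vec (a, p, q)) (rep (D b))) u)"
proof -
  have "lin_ext pm_scale (\<lambda>(a, b). lin_ext pm_scale (\<lambda>(p, q). basis_vec (a, p, q)) (rep (D b)))
    (rep (coset (tensor2_null s) u) - u) \<in> tensor3_null s"
  proof (rule lin_ext_tensor2_null_mod[OF subspace_tensor3_null _ _ rep_coset[OF subspace_tensor2_null]])
    show "lin_mod (tensor3_null s) s
        (\<lambda>a. lin_ext pm_scale (\<lambda>(p, q). basis_vec (a, p, q)) (rep (D b)))" for b
      unfolding case_prod_unfold by (rule lin_mod_fun_lin_ext[OF subspace_tensor3_null lin_mod_pure3_1])
    show "lin_mod (tensor3_null s) s
        (\<lambda>b. lin_ext pm_scale (\<lambda>(p, q). basis_vec (a, p, q)) (rep (D b)))" for a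
      by (rule lin_mod_linear_comp[OF assms linear_lin_ext[OF vector_space_pm_scale] lin_ext_pure3_null(2)])
  qed
  then show ?thesis
    by (simp add: id_coprod_def coset_eq_iff[OF subspace_tensor3_null]
      lin_ext_diff[OF vector_space_pm_scale])
qed

lemma coprod_id_coset:
  assumes "lin_mod (tensor2_null s) s (\<lambda>a. rep (D a))"
  shows "coprod_id s D (coset (tensor2_null s) u) = coset (tensor3_null s)
     (lin_ext pm_scale (\<lambda>(a, b). lin_ext pm_scale (\<lambda>(p, q). basis_vec (p, q, b)) (rep (D a))) u)"
proof -
  have "lin_ext pm_scale (\<lambda>(a, b). lin_ext pm_scale (\<lambda>(p, q). basis_vec (p, q, b)) (rep (D a)))
    (rep (coset (tensor2_null s) u) - u) \<in> tensor3_null s"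
  proof (rule lin_ext_tensor2_null_mod[OF subspace_tensor3_null _ _ rep_coset[OF subspace_tensor2_null]])
    show "lin_mod (tensor3_null s) s
        (\<lambda>a. lin_ext pm_scale (\<lambda>(p, q). basis_vec (p, q, b)) (rep (D a)))" for b
      by (rule lin_mod_linear_comp[OF assms linear_lin_ext[OF vector_space_pm_scale] lin_ext_pure3_null(1)])
    show "lin_mod (tensor3_null s) s
        (\<lambda>b. lin_ext pm_scale (\<lambda>(p, q). basis_vec (p, q, b)) (rep (D a)))" for a
      unfolding case_prod_unfold by (rule lin_mod_fun_lin_ext[OF subspace_tensor3_null lin_mod_pure3_3])
  qed
  then show ?thesis
    by (simp add: coprod_id_def coset_eq_iff[OF subspace_tensor3_null]
      lin_ext_diff[OF vector_space_pm_scale])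
qed

section \<open>Comparing maps modulo a subspace on basis vectors\<close>

lemma lin_mod_linear:
  assumes "pm.subspace N" "Vector_Spaces.linear s pm_scale f"
  shows "lin_mod N s f"
  by (simp add: lin_mod_def linear_add'[OF assms(2)] linear_scale'[OF assms(2)] pm.subspace_0[OF assms(1)])

lemma lin_mod_add:
  assumes N: "pm.subspace N" and f: "lin_mod N s f" and g: "lin_mod N s g"
  shows "lin_mod N s (\<lambda>a. f a + g a)"
  unfolding lin_mod_def
proof (intro conjI allI)
  fix a b c
  have "(f (a + b) - (f a + f b)) + (g (a + b) - (g a + g b)) \<in> N"
    using f g by (intro pm.subspace_add[OF N]) (auto simp: lin_mod_def)
  then show "f (a + b) + g (a + b) - (f a + g a + (f b + g b)) \<in> N"
    by (simp add: algebra_simps)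
  have "(f (s c a) - pm_scale c (f a)) + (g (s c a) - pm_scale c (g a)) \<in> N"
    using f g by (intro pm.subspace_add[OF N]) (auto simp: lin_mod_def)
  then show "f (s c a) + g (s c a) - pm_scale c (f a + g a) \<in> N"
    by (simp add: algebra_simps pm.scale_right_distrib)
qed

lemma mod_trans:
  assumes "pm.subspace N" "u - v \<in> N" "v - w \<in> N"
  shows "u - w \<in> N"
  using pm.subspace_add[OF assms] by simp

lemma mod_sym:
  assumes "pm.subspace N" "u - v \<in> N"
  shows "v - u \<in> N"
  using pm.subspace_neg[OF assms] by simp

text \<open>Needed for \<open>rep (eps_coprod u)\<close>, an arbitrary choice that differs by
  relations from the linear expression \<open>lin_cut_sum u\<close>.\<close>

lemma lin_mod_cong:
  assumes N: "pm.subspace N" and f: "lin_mod N s f" and fg: "\<And>a. g a - f a \<in> N"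
  shows "lin_mod N s g"
  unfolding lin_mod_def
proof (intro conjI allI)
  fix a b c
  have "f (a + b) - (f a + f b) \<in> N" using f by (simp add: lin_mod_def)
  from pm.subspace_diff[OF N pm.subspace_add[OF N this fg[of "a + b"]] pm.subspace_add[OF N fg[of a] fg[of b]]]
  show "g (a + b) - (g a + g b) \<in> N" by (simp add: algebra_simps)
  have "f (s c a) - pm_scale c (f a) \<in> N" using f by (simp add: lin_mod_def)
  from pm.subspace_diff[OF N pm.subspace_add[OF N this fg[of "s c a"]] pm.subspace_scale[OF N fg[of a], of c]]
  show "g (s c a) - pm_scale c (g a) \<in> N" by (simp add: algebra_simps pm.scale_right_diff_distrib)
qed

text \<open>Modulo \<open>N\<close> each map agrees with the linear extension of its values on basis
  vectors, and these two extensions agree term by term.\<close>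

lemma lin_mod_eqI_basis:
  assumes N: "pm.subspace N" and f: "lin_mod N pm_scale f" and g: "lin_mod N pm_scale g"
    and fg: "\<And>x. f (basis_vec x) - g (basis_vec x) \<in> N"
  shows "f u - g u \<in> N"
  using mod_trans[OF N lin_mod_lin_ext[OF N vector_space_pm_scale f, of basis_vec u]
    mod_trans[OF N lin_ext_cong_mod[OF N fg]
      mod_sym[OF N lin_mod_lin_ext[OF N vector_space_pm_scale g, of basis_vec u]]]]
  by (simp add: lin_ext_basis_vec_id)

section \<open>Convolution\<close>

text \<open>The coalgebra axioms equate cosets computed from \<open>rep\<close>, so the chosen
  representatives are additive and homogeneous only up to relations.\<close>

lemma lin_mod_coprod:
  assumes "coassociative_coalgebra A"
  shows "lin_mod (tensor2_null (scal A)) (scal A) (\<lambda>a. rep (coprod A a))"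
proof -
  interpret coassociative_coalgebra A by fact
  show ?thesis
    unfolding lin_mod_def coprod_add coprod_scale tensor2_add_def tensor2_scale_def
    by (intro conjI allI rep_coset subspace_tensor2_null)
qed

lemma coset_rep_coprod:
  assumes "coassociative_coalgebra A"
  shows "coset (tensor2_null (scal A)) (rep (coprod A a)) = coprod A a"
proof -
  obtain u where u: "coprod A a = coset (tensor2_null (scal A)) u"
    using coassociative_coalgebra.coprod_in[OF assms, of a] unfolding tensor2_space_def by (rule rangeE)
  show ?thesis unfolding u by (rule coset_rep[OF subspace_tensor2_null])
qed

lemma linear_mul_left:
  assumes "unitary_algebra L" "Vector_Spaces.linear s (scal L) f"
  shows "Vector_Spaces.linear s (scal L) (\<lambda>x. mul L (f x) y)"
  using linear_comp[OF assms(2) unitary_algebra.mul_linear_left[OF assms(1)]] .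

lemma linear_mul_right:
  assumes "unitary_algebra L" "Vector_Spaces.linear s (scal L) f"
  shows "Vector_Spaces.linear s (scal L) (\<lambda>x. mul L y (f x))"
  using linear_comp[OF assms(2) unitary_algebra.mul_linear_right[OF assms(1)]] .

text \<open>Convolution of maps between two different structures, so that comparing \<open>\<phi> \<circ> S\<^sub>H\<close> and
  \<open>S\<^sub>L \<circ> \<phi>\<close> becomes a matter of uniqueness of inverses.\<close>

definition conv_between ::
  "('k::field_char_0, 'a::ab_group_add, 'y) eps_alg_scheme \<Rightarrow>
   ('k, 'b::ab_group_add, 'z) eps_alg_scheme \<Rightarrow> ('a \<Rightarrow> 'b) \<Rightarrow> ('a \<Rightarrow> 'b) \<Rightarrow> 'a \<Rightarrow> 'b" where
  "conv_between H L f g a =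
     lin_ext (scal L) (\<lambda>(x, y). mul L (f x) (g y)) (rep (coprod H a))"

text \<open>The product of \<open>f x\<close> and \<open>g y\<close> is bilinear in \<open>x\<close>
  and \<open>y\<close>, so its linear extension vanishes on the difference of two
  representatives.\<close>

lemma conv_between_coset:
  assumes L: "unitary_algebra L"
    and f: "Vector_Spaces.linear (scal H) (scal L) f"
    and g: "Vector_Spaces.linear (scal H) (scal L) g"
    and a: "coprod H a = coset (tensor2_null (scal H)) u"
  shows "conv_between H L f g a = lin_ext (scal L) (\<lambda>(x, y). mul L (f x) (g y)) u"
  using lin_ext_tensor2_null[where \<beta> = "\<lambda>x y. mul L (f x) (g y)",
      OF linear_vs2[OF f] linear_mul_left[OF L f] linear_mul_right[OF L g]
        rep_coset[OF subspace_tensor2_null, of "scal H" u]]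
  by (simp add: conv_between_def a lin_ext_diff[OF linear_vs2[OF f]])

lemma linear_conv_between:
  assumes H: "coassociative_coalgebra H" and L: "unitary_algebra L"
    and f: "Vector_Spaces.linear (scal H) (scal L) f"
    and g: "Vector_Spaces.linear (scal H) (scal L) g"
  shows "Vector_Spaces.linear (scal H) (scal L) (conv_between H L f g)"
proof (rule linearI)
  interpret coassociative_coalgebra H by fact
  note V = linear_vs2[OF f]
  show "conv_between H L f g (x + y) = conv_between H L f g x + conv_between H L f g y" for x y
    by (subst conv_between_coset[OF L f g coprod_add[unfolded tensor2_add_def]])
       (simp add: lin_ext_add[OF V] conv_between_def)
  show "conv_between H L f g (scal H c x) = scal L c (conv_between H L f g x)" for c x
    by (subst conv_between_coset[OF L f g coprod_scale[unfolded tensor2_scale_def]])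
       (simp add: lin_ext_scale[OF V] conv_between_def)
qed (rule linear_vs1[OF f] linear_vs2[OF f])+

text \<open>By coassociativity the two iterated coproducts have representatives differing by an
  element of \<open>tensor3_null\<close>. The trilinear product of \<open>f p\<close>,
  \<open>g q\<close> and \<open>h r\<close> kills this difference.\<close>

lemma conv_between_assoc:
  assumes H: "coassociative_coalgebra H" and L: "unitary_algebra L"
    and f: "Vector_Spaces.linear (scal H) (scal L) f"
    and g: "Vector_Spaces.linear (scal H) (scal L) g"
    and h: "Vector_Spaces.linear (scal H) (scal L) h"
  shows "conv_between H L (conv_between H L f g) h a = conv_between H L f (conv_between H L g h) a"
proof -
  interpret H: coassociative_coalgebra H by fact
  interpret L: unitary_algebra L by fact
  note V = linear_vs2[OF f]
  let ?T = "lin_ext (scal L) (\<lambda>(p, q, r). mul L (mul L (f p) (g q)) (h r))"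
  let ?u = "lin_ext pm_scale (\<lambda>(a, b). lin_ext pm_scale (\<lambda>(p, q). basis_vec (p, q, b))
    (rep (coprod H a))) (rep (coprod H a))"
  let ?v = "lin_ext pm_scale (\<lambda>(a, b). lin_ext pm_scale (\<lambda>(p, q). basis_vec (a, p, q))
    (rep (coprod H b))) (rep (coprod H a))"
  have "?u - ?v \<in> tensor3_null (scal H)"
    using H.coassoc[of a]
    by (simp add: coprod_id_def id_coprod_def coset_eq_iff[OF subspace_tensor3_null])
  then have "?T (?u - ?v) = 0"
    by (rule lin_ext_tensor3_null[OF V, rotated -1])
       (intro linear_mul_left[OF L] linear_mul_right[OF L] f g h)+
  then have "?T ?u = ?T ?v" by (simp add: lin_ext_diff[OF V])
  moreover have "?T ?u = conv_between H L (conv_between H L f g) h a"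
    by (simp add: conv_between_def case_prod_unfold lin_ext_lin_ext[OF V] lin_ext_basis_vec[OF V]
        linear_apply_lin_ext[OF L.mul_linear_left])
  moreover have "?T ?v = conv_between H L f (conv_between H L g h) a"
    by (simp add: conv_between_def case_prod_unfold lin_ext_lin_ext[OF V] lin_ext_basis_vec[OF V]
        linear_apply_lin_ext[OF L.mul_linear_right] L.mul_assoc)
  ultimately show ?thesis by simp
qed

lemma
  assumes "unitary_algebra L"
  shows conv_between_add_left: "conv_between H L (\<lambda>x. f x + f' x) g a
      = conv_between H L f g a + conv_between H L f' g a"
    and conv_between_add_right: "conv_between H L f (\<lambda>x. g x + g' x) a
      = conv_between H L f g a + conv_between H L f g' a"
    and conv_between_zero_left: "conv_between H L (\<lambda>x. 0) g a = 0"
    and conv_between_zero_right: "conv_between H L f (\<lambda>x. 0) a = 0"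
proof -
  interpret L: unitary_algebra L by fact
  show "conv_between H L (\<lambda>x. f x + f' x) g a = conv_between H L f g a + conv_between H L f' g a"
    "conv_between H L f (\<lambda>x. g x + g' x) a = conv_between H L f g a + conv_between H L f g' a"
    by (simp_all only: conv_between_def case_prod_unfold linear_add'[OF L.mul_linear_left]
        linear_add'[OF L.mul_linear_right] lin_ext_fun_add[OF L.vector_space_axioms])
  show "conv_between H L (\<lambda>x. 0) g a = 0" "conv_between H L f (\<lambda>x. 0) a = 0"
    by (simp_all add: conv_between_def case_prod_unfold linear_zero'[OF L.mul_linear_left]
        linear_zero'[OF L.mul_linear_right] lin_ext_def)
qed

text \<open>In a monoid, a left inverse and a right inverse of the same element coincide. The unit
  of the circular convolution is the zero map, so the argument is written out with its extra linear
  terms.\<close>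

lemma conv_between_inverse_unique:
  assumes H: "coassociative_coalgebra H" and L: "unitary_algebra L"
    and f: "Vector_Spaces.linear (scal H) (scal L) f"
    and g: "Vector_Spaces.linear (scal H) (scal L) g"
    and h: "Vector_Spaces.linear (scal H) (scal L) h"
    and fg: "\<And>a. conv_between H L f g a + f a + g a = 0"
    and gh: "\<And>a. conv_between H L g h a + g a + h a = 0"
  shows "f a = h a"
proof -
  let ?c = "conv_between H L"
  \<comment> \<open>The equation for \<open>f\<close> and \<open>g\<close> is convolved with
    \<open>h\<close> on the right, the one for \<open>g\<close> and \<open>h\<close> with
    \<open>f\<close> on the left.\<close>
  have "?c (\<lambda>a. ?c f g a + f a + g a) h a = 0" "?c f (\<lambda>a. ?c g h a + g a + h a) a = 0"
    by (simp_all only: fg gh conv_between_zero_left[OF L] conv_between_zero_right[OF L])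
  then have "?c (?c f g) h a + ?c f h a + ?c g h a = 0" "?c f (?c g h) a + ?c f g a + ?c f h a = 0"
    by (simp_all only: conv_between_add_left[OF L] conv_between_add_right[OF L])
  then have "?c (?c f g) h a + ?c f h a + ?c g h a = ?c (?c f g) h a + ?c f h a + ?c f g a"
    by (simp only: conv_between_assoc[OF H L f g h] ac_simps)
  \<comment> \<open>After associativity, the two expansions differ only in these terms.\<close>
  then have eq: "?c g h a = ?c f g a" by (rule add_left_imp_eq)
  have "?c f g a + g a + f a = ?c f g a + g a + h a"
    using fg[of a] gh[of a] by (simp only: eq ac_simps)
  then show ?thesis by (rule add_left_imp_eq)
qed

section \<open>The antipode and its compatibility with bialgebra morphisms\<close>

lemma convolution_eq_conv_between:
  assumes A: "eps_bialgebra A"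
    and f: "Vector_Spaces.linear (scal A) (scal A) f"
    and g: "Vector_Spaces.linear (scal A) (scal A) g"
  shows "convolution A f g a = conv_between A A f g a"
proof -
  interpret eps_bialgebra A by fact
  note V = linear_vs2[OF f]
  show ?thesis
    by (simp add: convolution_def tensor2_map_def conv_between_def case_prod_unfold lin_ext_lin_ext[OF V]
        tensor2_lift_coset[OF V mul_linear_left mul_linear_right] lin_ext_basis_vec[OF V])
qed

lemma is_antipode_iff:
  assumes A: "eps_bialgebra A"
  shows "is_antipode A S \<longleftrightarrow> Vector_Spaces.linear (scal A) (scal A) S \<and>
    (\<forall>a. conv_between A A S (\<lambda>a. a) a + S a + a = 0) \<and>
    (\<forall>a. conv_between A A (\<lambda>a. a) S a + a + S a = 0)"
proof -
  interpret eps_bialgebra A by fact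
  show ?thesis
    using convolution_eq_conv_between[OF A, of S "\<lambda>a. a"] convolution_eq_conv_between[OF A, of "\<lambda>a. a" S]
      linear_ident'[OF vector_space_axioms]
    by (auto simp: is_antipode_def circ_convolution_def fun_eq_iff)
qed

text \<open>The definite description in \<open>antipode\<close> is meaningful because any two
  antipodes are a left and a right inverse of the identity, hence equal.\<close>

lemma is_antipode_antipode:
  assumes A: "eps_hopf_algebra A"
  shows "is_antipode A (antipode A)"
proof -
  interpret eps_hopf_algebra A by fact
  note [simp] = is_antipode_iff[OF eps_bialgebra_axioms]
  obtain S where S: "is_antipode A S" using antipode_exists ..
  have "S' = S" if "is_antipode A S'" for S'
    using S that linear_ident'[OF vector_space_axioms]
    by - (rule ext, rule conv_between_inverse_unique[where g = "\<lambda>a. a" and H = A and L = A,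
      OF coassociative_coalgebra_axioms unitary_algebra_axioms]; simp)
  with S show ?thesis unfolding antipode_def by (rule theI)
qed

lemma eps_bialgebra_hom_antipode:
  assumes H: "eps_hopf_algebra H" and L: "eps_hopf_algebra L" and \<phi>: "eps_bialgebra_hom H L \<phi>"
  shows "antipode L (\<phi> a) = \<phi> (antipode H a)"
proof -
  interpret H: eps_hopf_algebra H by fact
  interpret L: eps_hopf_algebra L by fact
  have lin: "Vector_Spaces.linear (scal H) (scal L) \<phi>"
    and mul: "\<phi> (mul H a b) = mul L (\<phi> a) (\<phi> b)"
    and cop: "coprod L (\<phi> a) = tensor2_map (scal L) \<phi> \<phi> (coprod H a)" for a b
    using \<phi> by (auto simp: eps_bialgebra_hom_def)
  note V = linear_vs2[OF lin]
  have SH: "Vector_Spaces.linear (scal H) (scal H) (antipode H)"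
    "conv_between H H (\<lambda>a. a) (antipode H) a + a + antipode H a = 0" for a
    using is_antipode_antipode[OF H] by (auto simp: is_antipode_iff[OF H.eps_bialgebra_axioms])
  have SL: "Vector_Spaces.linear (scal L) (scal L) (antipode L)"
    "conv_between L L (antipode L) (\<lambda>a. a) a + antipode L a + a = 0" for a
    using is_antipode_antipode[OF L] by (auto simp: is_antipode_iff[OF L.eps_bialgebra_axioms])
  show ?thesis
  proof (rule conv_between_inverse_unique[where g = \<phi> and H = H and L = L and
        f = "\<lambda>a. antipode L (\<phi> a)" and h = "\<lambda>a. \<phi> (antipode H a)"])
    fix a
    \<comment> \<open>Since \<open>\<phi>\<close> respects coproducts, the image under
      \<open>\<phi>\<close> of a representative of \<open>coprod H a\<close> represents
      \<open>coprod L (\<phi> a)\<close>. This moves the convolution from \<open>L\<close> to maps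
      from \<open>H\<close> to \<open>L\<close>.\<close>
    have "conv_between L L (antipode L) (\<lambda>a. a) (\<phi> a) = conv_between H L (\<lambda>a. antipode L (\<phi> a)) \<phi> a"
      by (subst conv_between_coset[OF L.unitary_algebra_axioms SL(1) linear_ident'[OF V]
            cop[unfolded tensor2_map_def]])
         (simp add: conv_between_def case_prod_unfold lin_ext_lin_ext[OF V] lin_ext_basis_vec[OF V])
    with SL(2)[of "\<phi> a"] show "conv_between H L (\<lambda>a. antipode L (\<phi> a)) \<phi> a + antipode L (\<phi> a) + \<phi> a = 0"
      by simp
    \<comment> \<open>For the other side, multiplicativity and linearity of \<open>\<phi>\<close>
      suffice.\<close>
    have "\<phi> (conv_between H H (\<lambda>a. a) (antipode H) a) = conv_between H L \<phi> (\<lambda>a. \<phi> (antipode H a)) a"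
      by (simp add: conv_between_def case_prod_unfold linear_apply_lin_ext[OF lin] mul)
    with arg_cong[OF SH(2)[of a], of \<phi>]
    show "conv_between H L \<phi> (\<lambda>a. \<phi> (antipode H a)) a + \<phi> a + \<phi> (antipode H a) = 0"
      by (simp add: linear_add'[OF lin] linear_zero'[OF lin])
  qed (rule H.coassociative_coalgebra_axioms L.unitary_algebra_axioms lin
      linear_comp[OF lin SL(1)] linear_comp[OF SH(1) lin])+
qed

section \<open>The coproduct of planar forests\<close>

lemma linear_forest_mul_left: "Vector_Spaces.linear pm_scale pm_scale (\<lambda>u. forest_mul u v)"
  unfolding forest_mul_def by (rule linear_lin_ext[OF vector_space_pm_scale])

lemma linear_forest_mul_right: "Vector_Spaces.linear pm_scale pm_scale (forest_mul u)"
  unfolding forest_mul_def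
  by (intro linear_fun_lin_ext linear_lin_ext vector_space_pm_scale)

lemma linear_B_plus: "Vector_Spaces.linear pm_scale pm_scale B_plus"
  unfolding B_plus_def by (rule linear_lin_ext[OF vector_space_pm_scale])

lemma forest_mul_basis: "forest_mul (basis_vec F) (basis_vec G) = basis_vec (F @ G)"
  by (simp add: forest_mul_def lin_ext_basis_vec[OF vector_space_pm_scale])

lemma B_plus_basis: "B_plus (basis_vec F) = basis_vec [Node F]"
  by (simp add: B_plus_def lin_ext_basis_vec[OF vector_space_pm_scale])

lemma forest_hopf_simps [simp]:
  "scal forest_hopf = pm_scale" "mul forest_hopf = forest_mul" "one_el forest_hopf = forest_one"
  "coprod forest_hopf = eps_coprod" "oper forest_hopf = B_plus"
  by (simp_all add: forest_hopf_def)

lemma forest_mul_assoc: "forest_mul (forest_mul u v) w = forest_mul u (forest_mul v w)"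
proof -
  note lin = linear_forest_mul_left linear_forest_mul_right
    linear_comp[OF linear_forest_mul_left linear_forest_mul_left]
    linear_comp[OF linear_forest_mul_left linear_forest_mul_right]
    linear_comp[OF linear_forest_mul_right linear_forest_mul_left]
    linear_comp[OF linear_forest_mul_right linear_forest_mul_right]
  \<comment> \<open>On basis forests this is associativity of list concatenation; it is extended
    linearly in \<open>w\<close>, then in \<open>v\<close>, then in \<open>u\<close>.\<close>
  have *: "forest_mul (forest_mul (basis_vec F) (basis_vec G)) w
      = forest_mul (basis_vec F) (forest_mul (basis_vec G) w)" for F G
    by (rule linear_eqI_basis[where s = pm_scale]) (rule lin | simp add: forest_mul_basis)+
  have **: "forest_mul (forest_mul (basis_vec F) v) w = forest_mul (basis_vec F) (forest_mul v w)" for F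
    by (rule linear_eqI_basis[where s = pm_scale and u = v]) (rule lin *)+
  show ?thesis
    by (rule linear_eqI_basis[where s = pm_scale and u = u]) (rule lin **)+
qed

lemma unitary_algebra_forest:
  "unitary_algebra (forest_hopf :: ('k::field_char_0, forest \<Rightarrow>\<^sub>0 'k) operated_eps_alg)"
proof (intro unitary_algebra.intro unitary_algebra_axioms.intro, unfold forest_hopf_simps)
  fix u v w :: "forest \<Rightarrow>\<^sub>0 'k"
  show "forest_mul forest_one u = u"
    by (rule linear_eqI_basis[where s = pm_scale])
      (simp_all add: forest_one_def forest_mul_basis linear_forest_mul_right
        linear_ident'[OF vector_space_pm_scale])
  show "forest_mul u forest_one = u"
    by (rule linear_eqI_basis[where s = pm_scale])
      (simp_all add: forest_one_def forest_mul_basis linear_forest_mul_left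
        linear_ident'[OF vector_space_pm_scale])
qed (rule vector_space_pm_scale linear_forest_mul_left linear_forest_mul_right forest_mul_assoc)+

text \<open>One term for each vertex \<open>v\<close>: removing \<open>v\<close> leaves the forest \<open>b\<close> made of the ancestors of \<open>v\<close> and
  everything to the right of the path from the root to \<open>v\<close>, and the forest \<open>a\<close> made of all other vertices.\<close>

fun cuts :: "forest \<Rightarrow> (forest \<times> forest) list" where
  "cuts [] = []"
| "cuts (Node F # Ts) = map (\<lambda>(a, b). (Node F # a, b)) (cuts Ts) @ (F, Ts) #
     map (\<lambda>(a, b). (a, Node b # Ts)) (cuts F)"

fun vertices :: "forest \<Rightarrow> nat" where
  "vertices [] = 0"
| "vertices (Node F # Ts) = Suc (vertices F + vertices Ts)"

text \<open>The removed vertex lies in neither part. This makes the antipode recursions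
  terminate.\<close>

lemma vertices_cuts:
  "(a, b) \<in> set (cuts F) \<Longrightarrow> vertices a < vertices F \<and> vertices b < vertices F"
  by (induction F arbitrary: a b rule: cuts.induct) fastforce+

text \<open>The removed vertex lies either in \<open>G\<close>, and then \<open>F\<close> stays
  whole on the left, or in \<open>F\<close>, and then \<open>G\<close> stays whole on the right.
  This is the derivation rule before passing to tensors.\<close>

lemma cuts_append:
  fixes g :: "forest \<Rightarrow> forest \<Rightarrow> 'v::comm_monoid_add"
  shows "(\<Sum>(a, b)\<leftarrow>cuts (F @ G). g a b)
    = (\<Sum>(a, b)\<leftarrow>cuts G. g (F @ a) b) + (\<Sum>(a, b)\<leftarrow>cuts F. g a (b @ G))"
proof (induction F arbitrary: g rule: cuts.induct)
  case (2 F Ts)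
  show ?case
    using 2(1)[of "\<lambda>a. g (Node F # a)"]
    by (simp add: case_prod_unfold comp_def ac_simps)
qed simp

lemma sum_list_swap:
  fixes g :: "'a \<Rightarrow> 'b \<Rightarrow> 'v::comm_monoid_add"
  shows "(\<Sum>x\<leftarrow>xs. \<Sum>y\<leftarrow>ys. g x y) = (\<Sum>y\<leftarrow>ys. \<Sum>x\<leftarrow>xs. g x y)"
  by (induction xs) (simp_all add: sum_list_addf)

text \<open>A cut separates the vertices before the removed one in postorder from those after it.
  Either side therefore sums over pairs of vertices, with the forests before, between and after them
  as the three factors.\<close>

lemma cuts_coassoc:
  fixes g :: "forest \<Rightarrow> forest \<Rightarrow> forest \<Rightarrow> 'v::comm_monoid_add"
  shows "(\<Sum>(a, b)\<leftarrow>cuts F. \<Sum>(p, q)\<leftarrow>cuts a. g p q b)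
    = (\<Sum>(a, b)\<leftarrow>cuts F. \<Sum>(p, q)\<leftarrow>cuts b. g a p q)"
proof (induction F arbitrary: g rule: cuts.induct)
  case (2 F Ts)
  \<comment> \<open>Pairs inside \<open>Ts\<close> or inside \<open>F\<close> are covered by the
    induction hypotheses. Pairs with one vertex in each occur on both sides with the order of
    summation exchanged.\<close>
  show ?case
    using 2(1)[of "\<lambda>a. g (Node F # a)"] 2(2)[of "\<lambda>a b c. g a b (Node c # Ts)"]
      sum_list_swap[of "\<lambda>x y. g (fst y) (Node (snd y) # fst x) (snd x)" "cuts F" "cuts Ts"]
    by (simp add: case_prod_unfold comp_def sum_list_addf ac_simps)
qed simp

text \<open>An element of the free space on pairs rather than a coset, so that its recursion rules
  are equations instead of congruences.\<close>

definition cut_sum :: "forest \<Rightarrow> ((forest \<Rightarrow>\<^sub>0 'k::field) \<times> (forest \<Rightarrow>\<^sub>0 'k)) \<Rightarrow>\<^sub>0 'k" where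
  "cut_sum F = (\<Sum>(a, b)\<leftarrow>cuts F. basis_vec (basis_vec a, basis_vec b))"

lemma lin_ext_cut_sum:
  assumes "vector_space s"
  shows "lin_ext s (\<lambda>(a, b). g a b) (cut_sum F) = (\<Sum>(a, b)\<leftarrow>cuts F. g (basis_vec a) (basis_vec b))"
  by (simp add: cut_sum_def case_prod_unfold lin_ext_sum_list[OF assms] lin_ext_basis_vec[OF assms])

lemma cut_sum_append:
  "cut_sum (F @ G)
    = lin_ext pm_scale (\<lambda>(a, b). basis_vec (forest_mul (basis_vec F) a, b)) (cut_sum G)
    + lin_ext pm_scale (\<lambda>(a, b). basis_vec (a, forest_mul b (basis_vec G))) (cut_sum F)"
  unfolding lin_ext_cut_sum[OF vector_space_pm_scale]
  by (simp add: cut_sum_def cuts_append forest_mul_basis)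

lemma cut_sum_Node:
  "cut_sum [Node F] = basis_vec (basis_vec F, forest_one)
    + lin_ext pm_scale (\<lambda>(a, b). basis_vec (a, B_plus b)) (cut_sum F)"
  unfolding lin_ext_cut_sum[OF vector_space_pm_scale]
  by (simp add: cut_sum_def forest_one_def B_plus_basis case_prod_unfold comp_def)

text \<open>The clauses of the coproduct match the rules for \<open>cut_sum\<close>; the last one is
  the concatenation rule for \<open>[T]\<close> and \<open>T' # Ts\<close>.\<close>

lemma eps_coprod_forest_eq:
  "eps_coprod_forest F = coset (tensor2_null pm_scale) (cut_sum F)"
proof (induction F rule: eps_coprod_forest.induct)
  case 1
  show ?case by (simp add: tensor2_zero_def cut_sum_def)
next
  case (2 F)
  show ?case
    unfolding eps_coprod_forest.simps 2 tensor2_pure_def cut_sum_Node tensor2_add_coset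
      tensor2_map_coset[OF linear_ident'[OF vector_space_pm_scale] linear_B_plus] ..
next
  case (3 T T' Ts)
  show ?case
    unfolding eps_coprod_forest.simps 3
      tensor2_map_coset[OF linear_ident'[OF vector_space_pm_scale] linear_forest_mul_left]
      tensor2_map_coset[OF linear_forest_mul_right linear_ident'[OF vector_space_pm_scale]]
      tensor2_add_coset
    by (simp only: cut_sum_append[of "[T]" "T' # Ts", unfolded append_Cons append_Nil])
qed

section \<open>The bialgebra structure on forests and the cocycle condition\<close>

abbreviation lin_cut_sum ::
  "(forest \<Rightarrow>\<^sub>0 'k::field) \<Rightarrow> ((forest \<Rightarrow>\<^sub>0 'k) \<times> (forest \<Rightarrow>\<^sub>0 'k)) \<Rightarrow>\<^sub>0 'k" where
  "lin_cut_sum \<equiv> lin_ext pm_scale cut_sum"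

lemma linear_lin_cut_sum: "Vector_Spaces.linear pm_scale pm_scale lin_cut_sum"
  by (rule linear_lin_ext[OF vector_space_pm_scale])

lemma eps_coprod_eq: "eps_coprod u = coset (tensor2_null pm_scale) (lin_cut_sum u)"
  unfolding eps_coprod_def eps_coprod_forest_eq coset_eq_iff[OF subspace_tensor2_null]
  by (rule lin_ext_cong_mod[OF subspace_tensor2_null rep_coset[OF subspace_tensor2_null]])

lemma rep_eps_coprod: "rep (eps_coprod u) - lin_cut_sum u \<in> tensor2_null pm_scale"
  unfolding eps_coprod_eq by (rule rep_coset[OF subspace_tensor2_null])

lemma lin_mod_rep_eps_coprod: "lin_mod (tensor2_null pm_scale) pm_scale (\<lambda>u. rep (eps_coprod u))"
  by (rule lin_mod_cong[OF subspace_tensor2_null _ rep_eps_coprod])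
    (rule lin_mod_linear[OF subspace_tensor2_null linear_lin_cut_sum])

lemma coassociative_coalgebra_forest:
  "coassociative_coalgebra (forest_hopf :: ('k::field_char_0, forest \<Rightarrow>\<^sub>0 'k) operated_eps_alg)"
proof (intro coassociative_coalgebra.intro coassociative_coalgebra_axioms.intro, unfold forest_hopf_simps)
  fix u v :: "forest \<Rightarrow>\<^sub>0 'k" and c :: 'k
  show "eps_coprod u \<in> tensor2_space pm_scale"
    unfolding eps_coprod_eq tensor2_space_def by (rule rangeI)
  show "eps_coprod (u + v) = tensor2_add pm_scale (eps_coprod u) (eps_coprod v)"
    unfolding eps_coprod_eq tensor2_add_coset linear_add'[OF linear_lin_cut_sum] ..
  show "eps_coprod (pm_scale c u) = tensor2_scale pm_scale c (eps_coprod u)"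
    unfolding eps_coprod_eq tensor2_scale_coset linear_scale'[OF linear_lin_cut_sum] ..
  note P = vector_space_pm_scale
  let ?l = "\<lambda>D u. lin_ext pm_scale
    (\<lambda>(a, b). lin_ext pm_scale (\<lambda>(p, q). basis_vec (p, q, b)) (D a)) (lin_cut_sum u)"
  let ?r = "\<lambda>D u. lin_ext pm_scale
    (\<lambda>(a, b). lin_ext pm_scale (\<lambda>(p, q). basis_vec (a, p, q)) (D b)) (lin_cut_sum u)"
  let ?D = "\<lambda>u. rep (eps_coprod u)" and ?N = "tensor3_null pm_scale"
  \<comment> \<open>Inside the outer sum, the representatives chosen by \<open>rep\<close> are
    exchanged for cut sums, at the cost of three-fold relations.\<close>
  have l: "?l ?D u - ?l lin_cut_sum u \<in> ?N" and r: "?r ?D u - ?r lin_cut_sum u \<in> ?N"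
    unfolding case_prod_unfold
    by (rule lin_ext_cong_mod[OF subspace_tensor3_null],
        unfold lin_ext_diff[OF P, symmetric],
        rule lin_ext_pure3_null[OF rep_eps_coprod, unfolded case_prod_unfold])+
  \<comment> \<open>With cut sums coassociativity holds exactly, not just modulo relations.\<close>
  have lr: "?l lin_cut_sum u = ?r lin_cut_sum u"
  proof (rule linear_eqI_basis[where s = pm_scale and f = "?l lin_cut_sum" and g = "?r lin_cut_sum"])
    show "?l lin_cut_sum (basis_vec F) = ?r lin_cut_sum (basis_vec F)" for F
      by (simp only: lin_ext_basis_vec[OF P] lin_ext_cut_sum[OF P] cuts_coassoc)
  qed (rule linear_comp[OF linear_lin_cut_sum linear_lin_ext[OF P]])+
  have "?l ?D u - ?r ?D u \<in> ?N"
    by (rule mod_trans[OF subspace_tensor3_null l[unfolded lr] mod_sym[OF subspace_tensor3_null r]])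
  then show "coprod_id pm_scale eps_coprod (eps_coprod u) = id_coprod pm_scale eps_coprod (eps_coprod u)"
    unfolding eps_coprod_eq[of u] coprod_id_coset[OF lin_mod_rep_eps_coprod]
      id_coprod_coset[OF lin_mod_rep_eps_coprod] coset_eq_iff[OF subspace_tensor3_null] .
qed (rule vector_space_pm_scale)

lemma eps_coprod_forest_mul:
  fixes u v :: "forest \<Rightarrow>\<^sub>0 'k::field_char_0"
  shows "eps_coprod (forest_mul u v)
    = tensor2_add pm_scale (act_left forest_hopf u (eps_coprod v)) (act_right forest_hopf (eps_coprod u) v)"
proof -
  note P = vector_space_pm_scale and N = subspace_tensor2_null
  let ?N = "tensor2_null pm_scale"
  let ?f = "\<lambda>u v. lin_cut_sum (forest_mul u v)"
  let ?l = "\<lambda>u v. lin_ext pm_scale (\<lambda>(a, b). basis_vec (forest_mul u a, b)) (lin_cut_sum v)"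
  let ?r = "\<lambda>u v. lin_ext pm_scale (\<lambda>(a, b). basis_vec (a, forest_mul b v)) (lin_cut_sum u)"
  have f: "lin_mod ?N pm_scale (\<lambda>u. ?f u v)" "lin_mod ?N pm_scale (?f u)" for u v
    by (rule lin_mod_linear[OF N linear_comp[OF linear_forest_mul_left linear_lin_cut_sum]]
        lin_mod_linear[OF N linear_comp[OF linear_forest_mul_right linear_lin_cut_sum]])+
  \<comment> \<open>Here the variable enters inside \<open>basis_vec\<close>, so linearity holds
    only modulo relations. In the argument of \<open>lin_cut_sum\<close> it holds exactly, which
    gives \<open>l'\<close> and \<open>r'\<close>.\<close>
  have l: "lin_mod ?N pm_scale (\<lambda>u. ?l u v)" for v
    unfolding case_prod_unfold
    by (rule lin_mod_fun_lin_ext[OF N lin_mod_comp[OF lin_mod_pure_left linear_forest_mul_left]])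
  have r: "lin_mod ?N pm_scale (?r u)" for u
    unfolding case_prod_unfold
    by (rule lin_mod_fun_lin_ext[OF N lin_mod_comp[OF lin_mod_pure_right linear_forest_mul_right]])
  have l': "lin_mod ?N pm_scale (?l u)" and r': "lin_mod ?N pm_scale (\<lambda>u. ?r u v)" for u v
    by (rule lin_mod_linear[OF N linear_comp[OF linear_lin_cut_sum linear_lin_ext[OF P]]])+
  have basis: "?f (basis_vec F) (basis_vec G) - (?l (basis_vec F) (basis_vec G) + ?r (basis_vec F) (basis_vec G)) \<in> ?N"
    for F G :: forest
    by (simp only: forest_mul_basis lin_ext_basis_vec[OF P] cut_sum_append diff_self pm.subspace_0[OF N])
  have left: "?f (basis_vec F) v - (?l (basis_vec F) v + ?r (basis_vec F) v) \<in> ?N" for F :: forest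
    by (rule lin_mod_eqI_basis[OF N f(2) lin_mod_add[OF N l' r] basis])
  have "?f u v - (?l u v + ?r u v) \<in> ?N"
    by (rule lin_mod_eqI_basis[OF N f(1) lin_mod_add[OF N l r'] left])
  then show ?thesis
    unfolding act_left_def act_right_def forest_hopf_simps eps_coprod_eq
      tensor2_map_coset[OF linear_ident'[OF P] linear_forest_mul_left]
      tensor2_map_coset[OF linear_forest_mul_right linear_ident'[OF P]]
      tensor2_add_coset coset_eq_iff[OF N] .
qed

lemma eps_bialgebra_forest:
  "eps_bialgebra (forest_hopf :: ('k::field_char_0, forest \<Rightarrow>\<^sub>0 'k) operated_eps_alg)"
  by (intro eps_bialgebra.intro eps_bialgebra_axioms.intro unitary_algebra_forest
      coassociative_coalgebra_forest) (simp add: eps_coprod_forest_mul)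

lemma eps_coprod_B_plus:
  fixes u :: "forest \<Rightarrow>\<^sub>0 'k::field_char_0"
  shows "eps_coprod (B_plus u) = tensor2_add pm_scale (tensor2_pure pm_scale u forest_one)
    (tensor2_map pm_scale (\<lambda>b. b) B_plus (eps_coprod u))"
proof -
  note P = vector_space_pm_scale and N = subspace_tensor2_null
  let ?g = "\<lambda>u. lin_ext pm_scale (\<lambda>(a, b). basis_vec (a, B_plus b)) (lin_cut_sum u)"
  have f: "lin_mod (tensor2_null pm_scale) pm_scale (\<lambda>u. lin_cut_sum (B_plus u))"
    by (rule lin_mod_linear[OF N linear_comp[OF linear_B_plus linear_lin_cut_sum]])
  have g: "lin_mod (tensor2_null pm_scale) pm_scale ?g"
    by (rule lin_mod_linear[OF N linear_comp[OF linear_lin_cut_sum linear_lin_ext[OF P]]])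
  have basis: "lin_cut_sum (B_plus (basis_vec F)) - (basis_vec (basis_vec F, forest_one) + ?g (basis_vec F))
      \<in> tensor2_null pm_scale" for F :: forest
    by (simp only: B_plus_basis lin_ext_basis_vec[OF P] cut_sum_Node diff_self pm.subspace_0[OF N])
  have "lin_cut_sum (B_plus u) - (basis_vec (u, forest_one) + ?g u) \<in> tensor2_null pm_scale"
    by (rule lin_mod_eqI_basis[OF N f lin_mod_add[OF N lin_mod_pure_left g] basis])
  then show ?thesis
    unfolding eps_coprod_eq tensor2_pure_def tensor2_map_coset[OF linear_ident'[OF P] linear_B_plus]
      tensor2_add_coset coset_eq_iff[OF N] .
qed


section \<open>The antipode\<close>

text \<open>The coproduct of \<open>F\<close> only involves forests with fewer vertices, so a left and a right inverse of
  the identity can be defined by recursion. They coincide by associativity.\<close>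

function left_antipode :: "forest \<Rightarrow> (forest \<Rightarrow>\<^sub>0 'k::field)" where
  "left_antipode F =
     - (\<Sum>(a, b)\<leftarrow>cuts F. forest_mul (left_antipode a) (basis_vec b)) - basis_vec F"
  by auto
termination by (relation "measure vertices") (use vertices_cuts in auto)

function right_antipode :: "forest \<Rightarrow> (forest \<Rightarrow>\<^sub>0 'k::field)" where
  "right_antipode F =
     - (\<Sum>(a, b)\<leftarrow>cuts F. forest_mul (basis_vec a) (right_antipode b)) - basis_vec F"
  by auto
termination by (relation "measure vertices") (use vertices_cuts in auto)

declare left_antipode.simps [simp del] right_antipode.simps [simp del]

text \<open>Turns convolution on forests into the sum over cuts from which the antipode recursions
  are built.\<close>

lemma conv_between_forest_basis:
  fixes L :: "('k::field_char_0, 'b::ab_group_add, 'z) eps_alg_scheme"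
  assumes L: "unitary_algebra L"
    and f: "Vector_Spaces.linear pm_scale (scal L) f"
    and g: "Vector_Spaces.linear pm_scale (scal L) g"
  shows "conv_between forest_hopf L f g (basis_vec F)
    = (\<Sum>(a, b)\<leftarrow>cuts F. mul L (f (basis_vec a)) (g (basis_vec b)))"
proof -
  have "coprod forest_hopf (basis_vec F) = coset (tensor2_null (scal forest_hopf)) (cut_sum F)"
    by (simp add: eps_coprod_eq lin_ext_basis_vec[OF vector_space_pm_scale])
  from conv_between_coset[OF L _ _ this, of f g] f g show ?thesis
    by (simp add: lin_ext_cut_sum[OF linear_vs2[OF f]])
qed

lemma eps_hopf_algebra_forest:
  "eps_hopf_algebra (forest_hopf :: ('k::field_char_0, forest \<Rightarrow>\<^sub>0 'k) operated_eps_alg)"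
proof (intro eps_hopf_algebra.intro eps_hopf_algebra_axioms.intro eps_bialgebra_forest exI)
  let ?H = "forest_hopf :: ('k, forest \<Rightarrow>\<^sub>0 'k) operated_eps_alg"
  note P = vector_space_pm_scale
  define S R :: "(forest \<Rightarrow>\<^sub>0 'k) \<Rightarrow> (forest \<Rightarrow>\<^sub>0 'k)"
    where "S = lin_ext pm_scale left_antipode" and "R = lin_ext pm_scale right_antipode"
  have lin: "Vector_Spaces.linear pm_scale pm_scale S" "Vector_Spaces.linear pm_scale pm_scale R"
    "Vector_Spaces.linear pm_scale pm_scale (\<lambda>u :: forest \<Rightarrow>\<^sub>0 'k. u)"
    by (simp_all add: S_def R_def linear_lin_ext[OF P] linear_ident'[OF P])
  have basis: "S (basis_vec F) = left_antipode F" "R (basis_vec F) = right_antipode F" for F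
    by (simp_all add: S_def R_def lin_ext_basis_vec[OF P])
  have conv: "Vector_Spaces.linear pm_scale pm_scale (conv_between ?H ?H f g)"
    if "Vector_Spaces.linear pm_scale pm_scale f" "Vector_Spaces.linear pm_scale pm_scale g" for f g
    using linear_conv_between[OF coassociative_coalgebra_forest unitary_algebra_forest, of f g] that
    by simp
  have add: "Vector_Spaces.linear pm_scale pm_scale (\<lambda>u. f u + g u + h u)"
    if "Vector_Spaces.linear pm_scale pm_scale f" "Vector_Spaces.linear pm_scale pm_scale g"
      "Vector_Spaces.linear pm_scale pm_scale h" for f g h :: "(forest \<Rightarrow>\<^sub>0 'k) \<Rightarrow> (forest \<Rightarrow>\<^sub>0 'k)"
    using that by (intro linearI P)
      (simp_all add: linear_add' linear_scale' pm.scale_right_distrib ac_simps)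
  have zero: "Vector_Spaces.linear pm_scale pm_scale (\<lambda>u :: forest \<Rightarrow>\<^sub>0 'k. 0 :: forest \<Rightarrow>\<^sub>0 'k)"
    by (intro linearI P) simp_all
  \<comment> \<open>On basis forests this is the recursion of \<open>left_antipode\<close>
    rearranged; linearity does the rest. The equation for \<open>R\<close> is symmetric.\<close>
  have S: "conv_between ?H ?H S (\<lambda>u. u) u + S u + u = 0" for u
  proof (rule linear_eqI_basis[OF add[OF conv[OF lin(1,3)] lin(1,3)] zero])
    fix F
    show "conv_between ?H ?H S (\<lambda>u. u) (basis_vec F) + S (basis_vec F) + basis_vec F = 0"
      using conv_between_forest_basis[OF unitary_algebra_forest, of S "\<lambda>u. u" F] lin
      by (simp add: basis left_antipode.simps[of F])
  qed
  have R: "conv_between ?H ?H (\<lambda>u. u) R u + u + R u = 0" for u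
  proof (rule linear_eqI_basis[OF add[OF conv[OF lin(3,2)] lin(3,2)] zero])
    fix F
    show "conv_between ?H ?H (\<lambda>u. u) R (basis_vec F) + basis_vec F + R (basis_vec F) = 0"
      using conv_between_forest_basis[OF unitary_algebra_forest, of "\<lambda>u. u" R F] lin
      by (simp add: basis right_antipode.simps[of F])
  qed
  have "S u = R u" for u
    by (rule conv_between_inverse_unique[OF coassociative_coalgebra_forest unitary_algebra_forest _ _ _ S R])
      (simp_all add: lin)
  then have "S = R" by (rule ext)
  with S R lin show "is_antipode ?H S"
    by (simp add: is_antipode_iff[OF eps_bialgebra_forest])
qed

lemma cocycle_eps_hopf_algebra_forest:
  "cocycle_eps_hopf_algebra (forest_hopf :: ('k::field_char_0, forest \<Rightarrow>\<^sub>0 'k) operated_eps_alg)"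
  by (intro cocycle_eps_hopf_algebra.intro cocycle_eps_hopf_algebra_axioms.intro
      operated_eps_hopf_algebra.intro operated_eps_hopf_algebra_axioms.intro eps_hopf_algebra_forest)
    (simp_all add: linear_B_plus eps_coprod_B_plus)


section \<open>The universal morphism\<close>

fun forest_eval ::
  "('k::field_char_0, 'a::ab_group_add, 'z) operated_eps_alg_scheme \<Rightarrow> forest \<Rightarrow> 'a" where
  "forest_eval H [] = one_el H"
| "forest_eval H (Node F # Ts) = mul H (oper H (forest_eval H F)) (forest_eval H Ts)"

lemma forest_eval_append:
  assumes "unitary_algebra H"
  shows "forest_eval H (F @ G) = mul H (forest_eval H F) (forest_eval H G)"
proof -
  interpret unitary_algebra H by fact
  show ?thesis
    by (induction F rule: cuts.induct) (simp_all add: mul_one_left mul_assoc)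
qed

section \<open>Evaluation of forests and the coproduct of the target\<close>

lemma coprod_one:
  assumes "eps_bialgebra A"
  shows "coprod A (one_el A) = coset (tensor2_null (scal A)) 0"
proof -
  interpret eps_bialgebra A by fact
  note N = subspace_tensor2_null and one = mul_one_left mul_one_right
  let ?N = "tensor2_null (scal A)"
  define r where "r = rep (coprod A (one_el A))"
  have r: "coprod A (one_el A) = coset ?N r"
    unfolding r_def by (rule coset_rep_coprod[OF coassociative_coalgebra_axioms, symmetric])
  \<comment> \<open>Both actions of the unit reduce to this map, which may change the representative
    but fixes the coset.\<close>
  have id: "tensor2_map (scal A) (\<lambda>b. b) (\<lambda>c. c) (coset ?N r) = coset ?N r"
    by (simp add: tensor2_map_coset[OF linear_ident'[OF vector_space_axioms]
          linear_ident'[OF vector_space_axioms]] lin_ext_basis_vec_id)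
  \<comment> \<open>The derivation rule for the product of two units doubles
    \<open>r\<close>.\<close>
  have "coset ?N r = coset ?N (r + r)"
    using coprod_mul[of "one_el A" "one_el A"]
    by (simp only: act_left_def act_right_def one r id tensor2_add_coset)
  then have "coset ?N (r + r) = coset ?N r" ..
  then have "r \<in> ?N" by (simp only: coset_eq_iff[OF N] add_diff_cancel_left')
  then show ?thesis by (simp only: r coset_eq_iff[OF N] diff_zero)
qed

lemma coprod_forest_eval:
  assumes "cocycle_eps_hopf_algebra H"
  shows "coprod H (forest_eval H F) = coset (tensor2_null (scal H))
    (\<Sum>(a, b)\<leftarrow>cuts F. basis_vec (forest_eval H a, forest_eval H b))"
proof -
  interpret cocycle_eps_hopf_algebra H by fact
  note P = vector_space_pm_scale and id = linear_ident'[OF vector_space_axioms]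
  show ?thesis
  proof (induction F rule: cuts.induct)
    case 1
    show ?case by (simp add: coprod_one[OF eps_bialgebra_axioms])
  next
    case (2 F Ts)
    \<comment> \<open>Let \<open>x\<close> and \<open>y\<close> be the values of \<open>F\<close>
      and \<open>Ts\<close>. The three blocks of \<open>cuts\<close> arise in turn from
      \<open>P(x)\<close> acting on the coproduct of \<open>y\<close>, from
      \<open>x \<otimes> 1\<close> acted on by \<open>y\<close>, and from \<open>P\<close> applied
      to the right factors of the coproduct of \<open>x\<close>, followed by the action of
      \<open>y\<close>.\<close>
    show ?case
      unfolding forest_eval.simps coprod_mul cocycle 2 act_left_def act_right_def tensor2_pure_def
        tensor2_map_coset[OF id oper_linear] tensor2_add_coset
        tensor2_map_coset[OF mul_linear_right id] tensor2_map_coset[OF id mul_linear_left]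
      by (simp add: case_prod_unfold comp_def lin_ext_add[OF P] lin_ext_sum_list[OF P]
          lin_ext_basis_vec[OF P] mul_one_left)
  qed
qed

lemma eps_bialgebra_hom_forest_eval:
  assumes "cocycle_eps_hopf_algebra H"
  shows "eps_bialgebra_hom forest_hopf H (lin_ext (scal H) (forest_eval H))"
proof -
  interpret cocycle_eps_hopf_algebra H by fact
  note P = vector_space_pm_scale and N = subspace_tensor2_null and V = vector_space_axioms
  let ?\<phi> = "lin_ext (scal H) (forest_eval H)"
  have lin: "Vector_Spaces.linear pm_scale (scal H) ?\<phi>" by (rule linear_lin_ext[OF V])
  have basis: "?\<phi> (basis_vec F) = forest_eval H F" for F by (rule lin_ext_basis_vec[OF V])
  have mul_basis: "?\<phi> (forest_mul (basis_vec F) v) = mul H (?\<phi> (basis_vec F)) (?\<phi> v)" for F v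
    by (rule linear_eqI_basis[OF linear_comp[OF linear_forest_mul_right lin]
          linear_comp[OF lin mul_linear_right]])
      (simp add: forest_mul_basis basis forest_eval_append[OF unitary_algebra_axioms])
  have mul: "?\<phi> (forest_mul u v) = mul H (?\<phi> u) (?\<phi> v)" for u v
    by (rule linear_eqI_basis[OF linear_comp[OF linear_forest_mul_left lin]
          linear_comp[OF lin mul_linear_left] mul_basis])
  \<comment> \<open>Cosets are plain sets here, so the two coproducts are compared through
    representatives modulo relations, where checking basis forests suffices.\<close>
  have "rep (coprod H (?\<phi> u)) - lin_ext pm_scale (\<lambda>(a, b). basis_vec (?\<phi> a, ?\<phi> b)) (lin_cut_sum u)
      \<in> tensor2_null (scal H)" for u
  proof (rule lin_mod_eqI_basis[OF N, where f = "\<lambda>u. rep (coprod H (?\<phi> u))"])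
    show "lin_mod (tensor2_null (scal H)) pm_scale (\<lambda>u. rep (coprod H (?\<phi> u)))"
      by (rule lin_mod_comp[OF lin_mod_coprod[OF coassociative_coalgebra_axioms] lin])
    show "lin_mod (tensor2_null (scal H)) pm_scale
        (\<lambda>u. lin_ext pm_scale (\<lambda>(a, b). basis_vec (?\<phi> a, ?\<phi> b)) (lin_cut_sum u))"
      by (rule lin_mod_linear[OF N linear_comp[OF linear_lin_cut_sum linear_lin_ext[OF P]]])
    show "rep (coprod H (?\<phi> (basis_vec F)))
        - lin_ext pm_scale (\<lambda>(a, b). basis_vec (?\<phi> a, ?\<phi> b)) (lin_cut_sum (basis_vec F))
        \<in> tensor2_null (scal H)" for F
      unfolding basis coprod_forest_eval[OF assms] lin_ext_basis_vec[OF P] lin_ext_cut_sum[OF P]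
      by (rule rep_coset[OF N])
  qed
  then have "coset (tensor2_null (scal H)) (rep (coprod H (?\<phi> u)))
      = tensor2_map (scal H) ?\<phi> ?\<phi> (eps_coprod u)" for u
    unfolding eps_coprod_eq tensor2_map_coset[OF lin lin] coset_eq_iff[OF N] .
  then have "coprod H (?\<phi> u) = tensor2_map (scal H) ?\<phi> ?\<phi> (eps_coprod u)" for u
    unfolding coset_rep_coprod[OF coassociative_coalgebra_axioms] .
  then show ?thesis
    by (simp add: eps_bialgebra_hom_def lin mul forest_one_def basis)
qed

lemma ex1_operated_eps_hopf_hom_forest:
  fixes H :: "('k::field_char_0, 'a::ab_group_add) operated_eps_alg"
  assumes "cocycle_eps_hopf_algebra H"
  shows "\<exists>!\<phi>. operated_eps_hopf_hom forest_hopf H \<phi>"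
proof
  interpret cocycle_eps_hopf_algebra H by fact
  note V = vector_space_axioms
  let ?\<phi> = "lin_ext (scal H) (forest_eval H)"
  note hom = eps_bialgebra_hom_forest_eval[OF assms]
  have lin: "Vector_Spaces.linear pm_scale (scal H) ?\<phi>" by (rule linear_lin_ext[OF V])
  \<comment> \<open>The forest \<open>[Node F]\<close> evaluates with a trailing factor
    \<open>one_el H\<close>, which the right unit law removes.\<close>
  have "?\<phi> (B_plus u) = oper H (?\<phi> u)" for u
    by (rule linear_eqI_basis[OF linear_comp[OF linear_B_plus lin] linear_comp[OF lin oper_linear]])
      (simp add: B_plus_basis lin_ext_basis_vec[OF V] mul_one_right)
  with hom show "operated_eps_hopf_hom forest_hopf H ?\<phi>"
    by (simp add: operated_eps_hopf_hom_def eps_hopf_hom_def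
        eps_bialgebra_hom_antipode[OF eps_hopf_algebra_forest eps_hopf_algebra_axioms hom])
  fix \<psi> assume "operated_eps_hopf_hom forest_hopf H \<psi>"
  then have lin': "Vector_Spaces.linear pm_scale (scal H) \<psi>"
    and mul: "\<psi> (forest_mul u v) = mul H (\<psi> u) (\<psi> v)" and one: "\<psi> forest_one = one_el H"
    and op: "\<psi> (B_plus u) = oper H (\<psi> u)" for u v
    by (auto simp: operated_eps_hopf_hom_def eps_hopf_hom_def eps_bialgebra_hom_def)
  have "\<psi> (basis_vec F) = forest_eval H F" for F
  proof (induction F rule: cuts.induct)
    case 1
    show ?case using one by (simp add: forest_one_def)
  next
    case (2 F Ts)
    \<comment> \<open>A nonempty forest is a grafted tree times a remaining forest, so the morphism
      laws leave no choice for \<open>\<psi>\<close>.\<close>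
    have "(basis_vec (Node F # Ts) :: forest \<Rightarrow>\<^sub>0 'k) = forest_mul (B_plus (basis_vec F)) (basis_vec Ts)"
      by (simp add: B_plus_basis forest_mul_basis)
    then show ?case by (simp only: mul op 2 forest_eval.simps)
  qed
  then show "\<psi> = ?\<phi>"
    by - (rule ext, rule linear_eqI_basis[OF lin' lin], simp add: lin_ext_basis_vec[OF V])
qed

theorem corollary3p13:
  fixes j :: "'x \<Rightarrow> (forest \<Rightarrow>\<^sub>0 'k::field_char_0)"
  shows "free_cocycle_eps_hopf_algebra ({} :: 'x set) j
           (forest_hopf :: ('k, forest \<Rightarrow>\<^sub>0 'k) operated_eps_alg) TYPE('h::ab_group_add)
       \<and> initial_cocycle_eps_hopf_algebra
           (forest_hopf :: ('k, forest \<Rightarrow>\<^sub>0 'k) operated_eps_alg) TYPE('h)"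
  unfolding free_cocycle_eps_hopf_algebra_def initial_cocycle_eps_hopf_algebra_def
  \<comment> \<open>Over the empty set the conditions on \<open>f\<close> and \<open>j\<close> are
    vacuous, so freeness and initiality both reduce to the existence of exactly one
    morphism.\<close>
  by (simp add: cocycle_eps_hopf_algebra_forest ex1_operated_eps_hopf_hom_forest)

end
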